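(* Let $\Lambda_{a,b,c}\subset\mathbb R^3$ be a Sierpinski sponge with parameters $0<a\le b\le c<1$ and alphabet $\mathcal I$, such that $\underline t<\overline t$, where $$\underline t=\min_{(i,j)\in\mathcal J}\frac{\log m_{ij}}{-\log a},\qquad \overline t=\max_{(i,j)\in\mathcal J}\frac{\log m_{ij}}{-\log a}.$$ There exists a constant $C$ (depending only on $a,b,c$ and $\mathcal I$) such that for every sufficiently small $\varepsilon>0$ and every $(a,b,c;\varepsilon)$-sponge $\Lambda_{a,b,c;\varepsilon}$ with the same alphabet $\mathcal I$, $$\dim_{\mathrm H}\Lambda_{a,b,c}-C\varepsilon\ \le\ \dim_{\mathrm H}\Lambda_{a,b,c;\varepsilon}\ \le\ \dim_{\mathrm H}\Lambda_{a,b,c}+C\varepsilon.$$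
   Context: $\dim_{\mathrm H}$ denotes Hausdorff dimension. **Self-affine sponges in $\mathbb R^3$.** Let $\mathcal I=\{(i,j,k):1\le i\le m,\ 1\le j\le m_i,\ 1\le k\le m_{ij}\}$ be a finite index set, called the alphabet ($m,m_i,m_{ij}$ positive integers), and $\mathcal J=\{(i,j):(i,j,k)\in\mathcal I\text{ for some }k\}$. Let $c_i,b_{ij},a_{ijk}\in(0,1)$ satisfy $a_{ijk}\le b_{ij}\le c_i$, $\sum_{i=1}^mc_i\le1$, $\sum_{j=1}^{m_i}b_{ij}\le1$ for each $i$, and $\sum_{k=1}^{m_{ij}}a_{ijk}\le1$ for each $(i,j)\in\mathcal J$. Let $u_i,u_{ij},u_{ijk}\in[0,1)$ be strictly increasing in their last index and satisfy $u_{i+1}-u_i\ge c_i$, $u_{i(j+1)}-u_{ij}\ge b_{ij}$, $u_{ij(k+1)}-u_{ijk}\ge a_{ijk}$, where if the last index has its maximal value ($i=m$, $j=m_i$, $k=m_{ij}$, respectively) the first term of the difference is replaced by $1$. Define $A_{ijk}(x,y,z)=(a_{ijk}x+u_{ijk},\,b_{ij}y+u_{ij},\,c_iz+u_i)$ for $(i,j,k)\in\mathcal I$. The unique nonempty compact set $\Lambda\subset\mathbb R^3$ with $\Lambda=\bigcup_{(i,j,k)\in\mathcal I}A_{ijk}(\Lambda)$ is called a self-affine sponge (with alphabet $\mathcal I$). **$(a,b,c;\varepsilon)$-sponges.** For numbers $0<a\le b\le c<1$ and $\varepsilon\ge0$, a self-affine sponge is an $(a,b,c;\varepsilon)$-sponge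 if $$e^{-\varepsilon}\le\frac{a_{ijk}}a\le e^\varepsilon,\quad e^{-\varepsilon}\le\frac{b_{ij}}b\le e^\varepsilon,\quad e^{-\varepsilon}\le\frac{c_i}c\le e^\varepsilon\qquad\text{for every }(i,j,k)\in\mathcal I.$$ A Sierpinski sponge $\Lambda_{a,b,c}$ is an $(a,b,c;0)$-sponge, i.e. $a_{ijk}=a$, $b_{ij}=b$, $c_i=c$ for all indices. *)

theory Defs
  imports "HOL-Analysis.Analysis"
begin

section \<open>Hausdorff measure and Hausdorff dimension\<close>

text \<open>
  The summand \<open>diam(U)\<^sup>s\<close> uses the usual conventions: the empty set contributes \<open>0\<close>, and a nonempty
  set contributes \<open>1\<close> when \<open>s = 0\<close> (whereas \<open>0 powr 0 = 0\<close> in the library). Finite covers are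
  covered by the sequences below through padding with empty sets. Boundedness of the covering sets
  is required explicitly because \<^const>\<open>diameter\<close> is real-valued and meaningless on unbounded sets.
\<close>

definition diam_powr :: "real \<Rightarrow> 'a::metric_space set \<Rightarrow> ennreal" where
  "diam_powr s U = (if U = {} then 0 else if s = 0 then 1 else ennreal (diameter U powr s))"

definition delta_covers :: "real \<Rightarrow> 'a::metric_space set \<Rightarrow> (nat \<Rightarrow> 'a set) set" where
  "delta_covers \<delta> S = {U. (\<forall>n. bounded (U n) \<and> diameter (U n) \<le> \<delta>) \<and> S \<subseteq> (\<Union>n. U n)}"

definition hausdorff_premeasure :: "real \<Rightarrow> real \<Rightarrow> 'a::metric_space set \<Rightarrow> ennreal" where
  "hausdorff_premeasure s \<delta> S = (INF U \<in> delta_covers \<delta> S. \<Sum>n. diam_powr s (U n))"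

definition hausdorff_measure :: "real \<Rightarrow> 'a::metric_space set \<Rightarrow> ennreal" where
  "hausdorff_measure s S = (SUP \<delta> \<in> {0<..}. hausdorff_premeasure s \<delta> S)"

definition hausdorff_dim :: "'a::metric_space set \<Rightarrow> ereal" where
  "hausdorff_dim S = Inf {ereal s | s. 0 \<le> s \<and> hausdorff_measure s S = 0}"


section \<open>Self-affine sponges\<close>

text \<open>
  An alphabet is given by its numbers \<open>m\<close>, \<open>m1 i\<close>, \<open>m2 i j\<close>; the values of \<open>m1\<close> and \<open>m2\<close> at
  indices out of range are irrelevant.
\<close>

definition alphabet :: "nat \<Rightarrow> (nat \<Rightarrow> nat) \<Rightarrow> (nat \<Rightarrow> nat \<Rightarrow> nat) \<Rightarrow> (nat \<times> nat \<times> nat) set" where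
  "alphabet m m1 m2 = {(i, j, k). i \<in> {1..m} \<and> j \<in> {1..m1 i} \<and> k \<in> {1..m2 i j}}"

definition alphabet_proj :: "nat \<Rightarrow> (nat \<Rightarrow> nat) \<Rightarrow> (nat \<Rightarrow> nat \<Rightarrow> nat) \<Rightarrow> (nat \<times> nat) set" where
  "alphabet_proj m m1 m2 = {(i, j). \<exists>k. (i, j, k) \<in> alphabet m m1 m2}"

definition alphabet_sizes :: "nat \<Rightarrow> (nat \<Rightarrow> nat) \<Rightarrow> (nat \<Rightarrow> nat \<Rightarrow> nat) \<Rightarrow> bool" where
  "alphabet_sizes m m1 m2 \<longleftrightarrow>
     0 < m \<and> (\<forall>i\<in>{1..m}. 0 < m1 i) \<and> (\<forall>i\<in>{1..m}. \<forall>j\<in>{1..m1 i}. 0 < m2 i j)"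

text \<open>
  \<open>A\<^sub>i\<^sub>j\<^sub>k\<close> contracts by \<open>len3 i j k\<close>, \<open>len2 i j\<close>, \<open>len1 i\<close> and translates by \<open>pos3 i j k\<close>, \<open>pos2 i j\<close>,
  \<open>pos1 i\<close> in the first, second and third coordinate, respectively; that is, \<open>len3\<close>, \<open>len2\<close>, \<open>len1\<close>
  are \<open>a\<close>, \<open>b\<close>, \<open>c\<close>, and \<open>pos1\<close>, \<open>pos2\<close>, \<open>pos3\<close> are the numbers \<open>u\<close> with one, two and three indices.
\<close>

record sponge_data =
  len1 :: "nat \<Rightarrow> real"
  len2 :: "nat \<Rightarrow> nat \<Rightarrow> real"
  len3 :: "nat \<Rightarrow> nat \<Rightarrow> nat \<Rightarrow> real"
  pos1 :: "nat \<Rightarrow> real"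
  pos2 :: "nat \<Rightarrow> nat \<Rightarrow> real"
  pos3 :: "nat \<Rightarrow> nat \<Rightarrow> nat \<Rightarrow> real"

text \<open>The conditions on the lengths \<open>r\<close> and positions \<open>v\<close> as functions of the last of their indices.\<close>

definition admissible_intervals :: "nat \<Rightarrow> (nat \<Rightarrow> real) \<Rightarrow> (nat \<Rightarrow> real) \<Rightarrow> bool" where
  "admissible_intervals n r v \<longleftrightarrow>
     (\<forall>i\<in>{1..n}. r i \<in> {0<..<1}) \<and> (\<Sum>i=1..n. r i) \<le> 1 \<and>
     (\<forall>i\<in>{1..n}. v i \<in> {0..<1}) \<and> strict_mono_on {1..n} v \<and>
     (\<forall>i\<in>{1..n}. (if i = n then 1 else v (i + 1)) - v i \<ge> r i)"

definition admissible_data ::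
  "nat \<Rightarrow> (nat \<Rightarrow> nat) \<Rightarrow> (nat \<Rightarrow> nat \<Rightarrow> nat) \<Rightarrow> sponge_data \<Rightarrow> bool" where
  "admissible_data m m1 m2 D \<longleftrightarrow>
     (\<forall>(i, j, k)\<in>alphabet m m1 m2. len3 D i j k \<le> len2 D i j \<and> len2 D i j \<le> len1 D i) \<and>
     admissible_intervals m (len1 D) (pos1 D) \<and>
     (\<forall>i\<in>{1..m}. admissible_intervals (m1 i) (len2 D i) (pos2 D i)) \<and>
     (\<forall>(i, j)\<in>alphabet_proj m m1 m2. admissible_intervals (m2 i j) (len3 D i j) (pos3 D i j))"

definition sponge_map :: "sponge_data \<Rightarrow> nat \<times> nat \<times> nat \<Rightarrow> real^3 \<Rightarrow> real^3" where
  "sponge_map D = (\<lambda>(i, j, k) p.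
     vector [len3 D i j k * p $ 1 + pos3 D i j k, len2 D i j * p $ 2 + pos2 D i j, len1 D i * p $ 3 + pos1 D i])"

definition self_affine_sponge ::
  "nat \<Rightarrow> (nat \<Rightarrow> nat) \<Rightarrow> (nat \<Rightarrow> nat \<Rightarrow> nat) \<Rightarrow> sponge_data \<Rightarrow> (real^3) set \<Rightarrow> bool" where
  "self_affine_sponge m m1 m2 D \<Lambda> \<longleftrightarrow>
     admissible_data m m1 m2 D \<and> \<Lambda> \<noteq> {} \<and> compact \<Lambda> \<and>
     \<Lambda> = (\<Union>\<iota>\<in>alphabet m m1 m2. sponge_map D \<iota> ` \<Lambda>)"

definition abc_sponge ::
  "nat \<Rightarrow> (nat \<Rightarrow> nat) \<Rightarrow> (nat \<Rightarrow> nat \<Rightarrow> nat) \<Rightarrow> real \<Rightarrow> real \<Rightarrow> real \<Rightarrow> real \<Rightarrow> (real^3) set \<Rightarrow> bool" where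
  "abc_sponge m m1 m2 a b c \<epsilon> \<Lambda> \<longleftrightarrow>
     (\<exists>D. self_affine_sponge m m1 m2 D \<Lambda> \<and>
        (\<forall>(i, j, k)\<in>alphabet m m1 m2.
           len3 D i j k / a \<in> {exp (- \<epsilon>)..exp \<epsilon>} \<and>
           len2 D i j / b \<in> {exp (- \<epsilon>)..exp \<epsilon>} \<and>
           len1 D i / c \<in> {exp (- \<epsilon>)..exp \<epsilon>}))"

definition sierpinski_sponge ::
  "nat \<Rightarrow> (nat \<Rightarrow> nat) \<Rightarrow> (nat \<Rightarrow> nat \<Rightarrow> nat) \<Rightarrow> real \<Rightarrow> real \<Rightarrow> real \<Rightarrow> (real^3) set \<Rightarrow> bool" where
  "sierpinski_sponge m m1 m2 a b c \<Lambda> \<longleftrightarrow> abc_sponge m m1 m2 a b c 0 \<Lambda>"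

definition t_lower :: "nat \<Rightarrow> (nat \<Rightarrow> nat) \<Rightarrow> (nat \<Rightarrow> nat \<Rightarrow> nat) \<Rightarrow> real \<Rightarrow> real" where
  "t_lower m m1 m2 a = (MIN (i, j)\<in>alphabet_proj m m1 m2. ln (real (m2 i j)) / (- ln a))"

definition t_upper :: "nat \<Rightarrow> (nat \<Rightarrow> nat) \<Rightarrow> (nat \<Rightarrow> nat \<Rightarrow> nat) \<Rightarrow> real \<Rightarrow> real" where
  "t_upper m m1 m2 a = (MAX (i, j)\<in>alphabet_proj m m1 m2. ln (real (m2 i j)) / (- ln a))"

end

theory Submission
  imports Defs
begin

text \<open>
  The dimension of a sponge can be read off its symbolic space. Fix a scale \<open>r\<close> and follow a sequence
  of letters in each of the three coordinates until the product of the contraction ratios first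
  drops to \<open>r\<close>. The sequences sharing the digits read in this way form an approximate cube: a box
  whose three sides all have length comparable to \<open>r\<close>. Boxes of different approximate cubes have
  disjoint interiors, so a set of diameter \<open>r\<close> meets only boundedly many of them, and covers of the
  sponge by arbitrary sets may be replaced by covers by approximate cubes.

  Now compare two sponges with the same alphabet, and suppose that each ratio of the second is at
  most the \<open>\<theta>\<close>-th power of the corresponding ratio of the first. This inequality is multiplicative, so
  it persists for products along any sequence, of whatever length. Hence an approximate cube of
  scale \<open>r\<close> of the first sponge fixes digits that confine points of the second to a set of diameter
  at most \<open>3 * r powr \<theta>\<close>: passing from one sponge to the other along equal sequences is, up to bounded
  multiplicity, Hoelder continuous with exponent \<open>\<theta>\<close>. A cover of the first with small sum of \<open>s\<close>-th
  powers becomes a cover of the second with small sum of \<open>(s / \<theta>)\<close>-th powers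
  (\<open>hausdorff_measure_zero_transfer\<close>), and the dimension grows at most by the factor \<open>1 / \<theta>\<close>.

  In an \<open>(a, b, c; \<epsilon>)\<close>-sponge the logarithms of the ratios differ by at most \<open>\<epsilon>\<close> from \<open>ln a\<close>, \<open>ln b\<close> or
  \<open>ln c\<close>, and these numbers are at most \<open>ln c < 0\<close>. The error \<open>\<epsilon>\<close> is thus a small proportion of the
  logarithms, and \<open>\<theta> = 1 - \<epsilon> / (- ln c)\<close> serves for the comparison with the Sierpinski sponge in
  both directions (\<open>le_powr_of_ln_close\<close>). As all dimensions involved are bounded, the factor
  \<open>1 / \<theta>\<close> changes them by at most a constant times \<open>\<epsilon>\<close>.
\<close>

section \<open>Null sets of Hausdorff measure\<close>

lemma hausdorff_measure_zeroD:
  fixes S :: "'a::metric_space set"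
  assumes null: "hausdorff_measure s S = 0" and s: "0 < s" and \<eta>: "0 < \<eta>"
  obtains U r where "\<And>n::nat. 0 < (r n :: real)" "\<And>n x y. x \<in> U n \<Longrightarrow> y \<in> U n \<Longrightarrow> dist x y \<le> r n"
    "S \<subseteq> (\<Union>n. U n)" "(\<Sum>n. ennreal (r n powr s)) \<le> ennreal \<eta>"
proof -
  have "hausdorff_premeasure s 1 S \<le> hausdorff_measure s S"
    unfolding hausdorff_measure_def by (rule SUP_upper) simp
  then have "hausdorff_premeasure s 1 S < ennreal (\<eta> / 2)"
    using null \<eta> by simp
  then obtain U where U: "U \<in> delta_covers 1 S" and sum: "(\<Sum>n. diam_powr s (U n)) < ennreal (\<eta> / 2)"
    unfolding hausdorff_premeasure_def INF_less_iff by blast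
  \<comment> \<open>Covering sets may be single points; the extra summand keeps the radii positive.\<close>
  define g where "g n = diameter (U n) powr s + (\<eta> / 2) * (1 / 2) ^ Suc n" for n
  define r where "r n = g n powr (1 / s)" for n
  have bdd: "bounded (U n)" for n using U by (auto simp: delta_covers_def)
  have g_pos: "0 < g n" for n
    unfolding g_def using \<eta> by (intro add_nonneg_pos) auto
  have r_pos: "0 < r n" for n
    using g_pos[of n] by (simp add: r_def)
  have r_powr: "r n powr s = g n" for n
    using g_pos[of n] s by (simp add: r_def powr_powr)
  have diam_le: "diameter (U n) \<le> r n" for n
  proof -
    have "diameter (U n) = (diameter (U n) powr s) powr (1 / s)"
      using s diameter_ge_0[OF bdd] by (simp add: powr_powr)
    also have "\<dots> \<le> r n"
      unfolding r_def using \<eta> s by (intro powr_mono2) (auto simp: g_def)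
    finally show ?thesis .
  qed
  show ?thesis
  proof (rule that[of r U])
    show "0 < r n" for n by (rule r_pos)
    show "dist x y \<le> r n" if "x \<in> U n" "y \<in> U n" for n x y
      using diameter_bounded_bound[OF bdd that] diam_le[of n] by simp
    show "S \<subseteq> (\<Union>n. U n)" using U by (auto simp: delta_covers_def)
    have geo: "(\<lambda>n. (\<eta> / 2) * (1 / 2) ^ Suc n) sums (\<eta> / 2 * 1)"
      by (intro sums_mult power_half_series)
    have "(\<Sum>n. ennreal (r n powr s))
        = (\<Sum>n. ennreal (diameter (U n) powr s) + ennreal ((\<eta> / 2) * (1 / 2) ^ Suc n))"
      unfolding r_powr g_def using \<eta> by (intro arg_cong[where f = suminf] ext ennreal_plus) auto
    also have "\<dots> = (\<Sum>n. ennreal (diameter (U n) powr s)) + (\<Sum>n. ennreal ((\<eta> / 2) * (1 / 2) ^ Suc n))"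
      by (rule suminf_add[symmetric]) auto
    also have "(\<Sum>n. ennreal (diameter (U n) powr s)) = (\<Sum>n. diam_powr s (U n))"
      using s by (intro arg_cong[where f = suminf] ext) (auto simp: diam_powr_def)
    also have "(\<Sum>n. ennreal ((\<eta> / 2) * (1 / 2) ^ Suc n)) = ennreal (\<eta> / 2)"
      using \<eta> geo by (intro suminf_ennreal_eq) auto
    also have "(\<Sum>n. diam_powr s (U n)) + ennreal (\<eta> / 2) \<le> ennreal (\<eta> / 2) + ennreal (\<eta> / 2)"
      using sum by (intro add_right_mono) simp
    also have "\<dots> = ennreal \<eta>" using \<eta> by (simp flip: ennreal_plus)
    finally show "(\<Sum>n. ennreal (r n powr s)) \<le> ennreal \<eta>" .
  qed
qed

text \<open>
  No bound on the diameters of the covers is asked for: since a single summand is at most \<open>\<eta>\<close>, a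
  cover whose sum is small consists of small sets. Each step \<open>n\<close> may contribute finitely many sets,
  which is how one covering set of a sponge is replaced by several of another.
\<close>

lemma hausdorff_measure_zeroI:
  fixes S :: "'a::metric_space set"
  assumes s: "0 < s"
    and covers: "\<And>\<eta>. 0 < \<eta> \<Longrightarrow> \<exists>(U :: nat \<Rightarrow> 'c::countable \<Rightarrow> 'a set) F r.
      (\<forall>n. finite (F n) \<and> 0 \<le> r n) \<and> (\<forall>n. \<forall>f\<in>F n. \<forall>x\<in>U n f. \<forall>y\<in>U n f. dist x y \<le> r n) \<and>
      S \<subseteq> (\<Union>n. \<Union>f\<in>F n. U n f) \<and>
      (\<Sum>n. of_nat (card (F n)) * ennreal (r n powr s)) \<le> ennreal \<eta>"
  shows "hausdorff_measure s S = 0"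
proof -
  have "hausdorff_premeasure s \<delta> S \<le> 0 + ennreal e" if \<delta>: "0 < \<delta>" and e: "0 < e" for \<delta> e
  proof -
    define \<eta> where "\<eta> = min e (\<delta> powr s)"
    have \<eta>: "0 < \<eta>" "\<eta> \<le> e" "\<eta> \<le> \<delta> powr s"
      using \<delta> e by (auto simp: \<eta>_def)
    from covers[OF \<eta>(1)] obtain U :: "nat \<Rightarrow> 'c \<Rightarrow> 'a set" and F r
      where cover: "(\<forall>n. finite (F n) \<and> 0 \<le> r n) \<and>
        (\<forall>n. \<forall>f\<in>F n. \<forall>x\<in>U n f. \<forall>y\<in>U n f. dist x y \<le> r n) \<and> S \<subseteq> (\<Union>n. \<Union>f\<in>F n. U n f) \<and>
        (\<Sum>n. of_nat (card (F n)) * ennreal (r n powr s)) \<le> ennreal \<eta>"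
      by (elim exE) (rule that)
    then have F: "finite (F n)" and r: "0 \<le> r n" for n by simp_all
    from cover have dist: "dist x y \<le> r n" if "f \<in> F n" "x \<in> U n f" "y \<in> U n f" for n f x y
      using that by simp
    from cover have cov: "S \<subseteq> (\<Union>n. \<Union>f\<in>F n. U n f)"
      and sum: "(\<Sum>n. of_nat (card (F n)) * ennreal (r n powr s)) \<le> ennreal \<eta>"
      by simp_all
    define V where "V = (\<lambda>(n, k). if k \<in> to_nat ` F n then U n (from_nat k) else {})"
    define W where "W i = V (prod_decode i)" for i
    have V_dist: "dist x y \<le> r n" if "x \<in> V (n, k)" "y \<in> V (n, k)" for n k x y
      using that dist by (auto simp: V_def split: if_splits)
    have r_small: "r n \<le> \<delta>" if "F n \<noteq> {}" for n
    proof -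
      have "1 \<le> card (F n)" using that F[of n] by (simp add: Suc_le_eq card_gt_0_iff)
      then have "1 * ennreal (r n powr s) \<le> of_nat (card (F n)) * ennreal (r n powr s)"
        by (intro mult_right_mono) (use of_nat_mono[of 1 "card (F n)"] in auto)
      also have "\<dots> \<le> (\<Sum>n. of_nat (card (F n)) * ennreal (r n powr s))"
        using sum_le_suminf[OF summableI, of "{n}" "\<lambda>n. of_nat (card (F n)) * ennreal (r n powr s)"]
        by simp
      also have "\<dots> \<le> ennreal (\<delta> powr s)"
        using sum \<eta>(3) by (meson ennreal_leI order_trans)
      finally have "r n powr s \<le> \<delta> powr s"
        by (simp add: ennreal_le_iff)
      then show ?thesis
        using s \<delta> r[of n] by (meson linorder_not_le powr_less_mono2 less_imp_le)
    qed
    have "W i = {} \<or> (bounded (W i) \<and> diameter (W i) \<le> \<delta>)" for i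
    proof -
      obtain n k where nk: "prod_decode i = (n, k)" by fastforce
      show ?thesis
      proof (cases "k \<in> to_nat ` F n")
        case True
        have d: "dist x y \<le> r n" if "x \<in> W i" "y \<in> W i" for x y
          using V_dist that nk by (simp add: W_def)
        have "bounded (W i)" unfolding bounded_two_points using d by blast
        moreover have "diameter (W i) \<le> r n"
        proof (cases "W i = {}")
          case True then show ?thesis using r by simp
        next
          case False
          then show ?thesis unfolding diameter_def using d by (auto intro!: cSUP_least)
        qed
        ultimately show ?thesis using r_small[of n] True by force
      next
        case False then show ?thesis by (simp add: W_def V_def nk)
      qed
    qed
    then have small: "bounded (W i) \<and> diameter (W i) \<le> \<delta>" for i
      using \<delta> by (metis bounded_empty diameter_empty less_imp_le)
    have "S \<subseteq> (\<Union>i. W i)"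
    proof
      fix x assume "x \<in> S"
      then obtain n f where nf: "f \<in> F n" "x \<in> U n f" using cov by blast
      then have "x \<in> W (prod_encode (n, to_nat f))" by (simp add: W_def V_def)
      then show "x \<in> (\<Union>i. W i)" by blast
    qed
    with small have W: "W \<in> delta_covers \<delta> S" by (simp add: delta_covers_def)
    have inner: "(\<Sum>k. diam_powr s (V (n, k))) \<le> of_nat (card (F n)) * ennreal (r n powr s)" for n
    proof -
      have "(\<Sum>k. diam_powr s (V (n, k))) = (\<Sum>k\<in>to_nat ` F n. diam_powr s (V (n, k)))"
        using F[of n] by (intro suminf_finite) (auto simp: V_def diam_powr_def)
      also have "\<dots> \<le> (\<Sum>k\<in>to_nat ` F n. ennreal (r n powr s))"
      proof (rule sum_mono)
        fix k
        have "diam_powr s (V (n, k)) \<le> ennreal (r n powr s)" if "V (n, k) \<noteq> {}"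
        proof -
          have d: "diameter (V (n, k)) \<le> r n"
            unfolding diameter_def using V_dist that by (auto intro!: cSUP_least)
          have "bounded (V (n, k))" unfolding bounded_two_points using V_dist by blast
          then have "0 \<le> diameter (V (n, k))" by (rule diameter_ge_0)
          then show ?thesis using d s that by (auto simp: diam_powr_def intro!: ennreal_leI powr_mono2)
        qed
        then show "diam_powr s (V (n, k)) \<le> ennreal (r n powr s)"
          by (cases "V (n, k) = {}") (auto simp: diam_powr_def)
      qed
      also have "\<dots> = of_nat (card (F n)) * ennreal (r n powr s)"
        by (simp add: card_image)
      finally show ?thesis .
    qed
    have "hausdorff_premeasure s \<delta> S \<le> (\<Sum>i. diam_powr s (W i))"
      unfolding hausdorff_premeasure_def by (rule INF_lower[OF W])
    also have "\<dots> = (\<Sum>n. \<Sum>k. diam_powr s (V (n, k)))"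
      unfolding W_def by (rule suminf_ennreal_2dimen[where f = "\<lambda>p. diam_powr s (V p)"]) simp
    also have "\<dots> \<le> (\<Sum>n. of_nat (card (F n)) * ennreal (r n powr s))"
      by (intro suminf_le inner) auto
    also have "\<dots> \<le> ennreal e"
      using sum \<eta>(2) by (meson ennreal_leI order_trans)
    finally show ?thesis by simp
  qed
  then have "hausdorff_premeasure s \<delta> S \<le> 0" if "0 < \<delta>" for \<delta>
    using that by - (rule ennreal_le_epsilon, blast)
  then have "hausdorff_measure s S \<le> 0"
    unfolding hausdorff_measure_def by (intro SUP_least) simp
  then show ?thesis by simp
qed

text \<open>
  With exponent \<open>0\<close> every nonempty covering set contributes \<open>1\<close>. This reduces the comparison of
  sponges to positive exponents, for which small sums force small sets.
\<close>

lemma hausdorff_measure_zero_dimension: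
  assumes "hausdorff_measure 0 S = 0"
  shows "S = {}"
proof (rule ccontr)
  assume "S \<noteq> {}"
  have "1 \<le> (\<Sum>n. diam_powr 0 (U n))" if U: "U \<in> delta_covers 1 S" for U :: "nat \<Rightarrow> 'a set"
  proof -
    obtain n where n: "U n \<noteq> {}"
      using U \<open>S \<noteq> {}\<close> by (fastforce simp: delta_covers_def)
    have "(\<Sum>n\<in>{n}. diam_powr 0 (U n)) \<le> (\<Sum>n. diam_powr 0 (U n))"
      by (rule sum_le_suminf) auto
    with n show ?thesis by (simp add: diam_powr_def)
  qed
  then have "1 \<le> hausdorff_premeasure 0 1 S"
    unfolding hausdorff_premeasure_def by (intro INF_greatest)
  also have "\<dots> \<le> hausdorff_measure 0 S"
    unfolding hausdorff_measure_def by (rule SUP_upper) simp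
  finally show False using assms by simp
qed


text \<open>
  The grid of mesh \<open>1 / n\<close> covers the cube by \<open>(n + 1)^3\<close> sets of diameter at most \<open>3 / n\<close>, so the sums
  of fourth powers tend to \<open>0\<close>.
\<close>

lemma hausdorff_measure_4_unit_cube:
  fixes S :: "(real^3) set"
  assumes cube: "\<And>p d. p \<in> S \<Longrightarrow> 0 \<le> p $ d \<and> p $ d \<le> 1"
  shows "hausdorff_measure 4 S = 0"
proof (rule hausdorff_measure_zeroI[where 'c = "3 \<Rightarrow> int"])
  fix \<eta> :: real assume \<eta>: "0 < \<eta>"
  obtain N :: nat where N: "max 1 (648 / \<eta>) < real N" using reals_Archimedean2 by blast
  then have N1: "1 \<le> real N" "648 / \<eta> \<le> real N" by auto
  define G where "G = (PiE UNIV (\<lambda>_. {0..int N}) :: (3 \<Rightarrow> int) set)"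
  define U where "U n f = {p \<in> S. \<forall>d. \<lfloor>real N * p $ d\<rfloor> = f d}" for n :: nat and f
  define F where "F n = (if n = 0 then G else {})" for n :: nat
  have finG: "finite G" by (simp add: G_def finite_PiE)
  have cardG: "card G = (N + 1) ^ 3" by (simp add: G_def card_PiE nat_add_distrib)
  have "\<forall>n. finite (F n) \<and> 0 \<le> 3 / real N" by (simp add: F_def finG)
  moreover have "\<forall>n. \<forall>f\<in>F n. \<forall>x\<in>U n f. \<forall>y\<in>U n f. dist x y \<le> 3 / real N"
  proof (intro allI ballI)
    fix n f x y assume xy: "x \<in> U n f" "y \<in> U n f"
    have "\<bar>x $ d - y $ d\<bar> \<le> 1 / real N" for d
    proof -
      have "\<lfloor>real N * x $ d\<rfloor> = \<lfloor>real N * y $ d\<rfloor>" using xy by (simp add: U_def)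
      then have "\<bar>real N * x $ d - real N * y $ d\<bar> \<le> 1" by linarith
      then have "real N * \<bar>x $ d - y $ d\<bar> \<le> 1"
        by (simp add: abs_mult flip: right_diff_distrib)
      then show ?thesis using N1 by (simp add: field_simps)
    qed
    then have "(\<Sum>d\<in>UNIV. \<bar>(x - y) $ d\<bar>) \<le> (\<Sum>d\<in>(UNIV :: 3 set). 1 / real N)"
      by (intro sum_mono) simp
    then show "dist x y \<le> 3 / real N"
      using norm_le_l1_cart[of "x - y"] by (simp add: dist_norm)
  qed
  moreover have "S \<subseteq> (\<Union>n. \<Union>f\<in>F n. U n f)"
  proof
    fix p assume p: "p \<in> S"
    have "\<lfloor>real N * p $ d\<rfloor> \<in> {0..int N}" for d
    proof -
      have "0 \<le> real N * p $ d" "real N * p $ d \<le> real N * 1"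
        using cube[OF p, of d] by (auto intro!: mult_left_mono simp del: mult_1_right)
      then show ?thesis by (simp add: floor_le_iff)
    qed
    then have "(\<lambda>d. \<lfloor>real N * p $ d\<rfloor>) \<in> F 0" by (auto simp: F_def G_def)
    then show "p \<in> (\<Union>n. \<Union>f\<in>F n. U n f)" using p by (fastforce simp: U_def)
  qed
  moreover have "(\<Sum>n. of_nat (card (F n)) * ennreal ((3 / real N) powr 4)) \<le> ennreal \<eta>"
  proof -
    have "(\<Sum>n. of_nat (card (F n)) * ennreal ((3 / real N) powr 4))
        = of_nat (card G) * ennreal ((3 / real N) powr 4)"
      by (subst suminf_finite[of "{0}"]) (auto simp: F_def)
    also have "\<dots> = ennreal (real ((N + 1) ^ 3) * (3 / real N) ^ 4)"
      using N1 by (simp add: cardG ennreal_mult ennreal_of_nat_eq_real_of_nat powr_numeral)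
    also have "\<dots> \<le> ennreal \<eta>"
    proof (rule ennreal_leI)
      have "real ((N + 1) ^ 3) \<le> (2 * real N) ^ 3"
        unfolding of_nat_power using N1 by (intro power_mono) auto
      then have "real ((N + 1) ^ 3) * (3 / real N) ^ 4 \<le> (2 * real N) ^ 3 * (3 / real N) ^ 4"
        by (intro mult_right_mono) auto
      also have "\<dots> = 648 / real N" using N1 by (simp add: field_simps eval_nat_numeral)
      also have "\<dots> \<le> \<eta>" using N1 \<eta> by (simp add: field_simps)
      finally show "real ((N + 1) ^ 3) * (3 / real N) ^ 4 \<le> \<eta>" .
    qed
    finally show ?thesis .
  qed
  ultimately show "\<exists>U F r.
      (\<forall>n. finite (F n) \<and> 0 \<le> r n) \<and>
      (\<forall>n. \<forall>f\<in>F n. \<forall>x\<in>U n (f :: 3 \<Rightarrow> int). \<forall>y\<in>U n f. dist x y \<le> r n) \<and>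
      S \<subseteq> (\<Union>n. \<Union>f\<in>F n. U n f) \<and>
      (\<Sum>n. of_nat (card (F n)) * ennreal (r n powr 4)) \<le> ennreal \<eta>"
    by (intro exI[of _ U] exI[of _ F] exI[of _ "\<lambda>_. 3 / real N"]) blast
qed simp


section \<open>Cells on a line\<close>

definition cell_size :: "('l \<Rightarrow> real) \<Rightarrow> (nat \<Rightarrow> 'l) \<Rightarrow> nat \<Rightarrow> real" where
  "cell_size R \<omega> n = (\<Prod>l<n. R (\<omega> l))"

definition cell_left :: "('l \<Rightarrow> real) \<Rightarrow> ('l \<Rightarrow> real) \<Rightarrow> (nat \<Rightarrow> 'l) \<Rightarrow> nat \<Rightarrow> real" where
  "cell_left R V \<omega> n = (\<Sum>l<n. cell_size R \<omega> l * V (\<omega> l))"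

definition stop_time :: "('l \<Rightarrow> real) \<Rightarrow> real \<Rightarrow> (nat \<Rightarrow> 'l) \<Rightarrow> nat" where
  "stop_time R r \<omega> = (LEAST n. cell_size R \<omega> n \<le> r)"

text \<open>
  Composing the maps \<open>\<lambda>x. R \<iota> * x + V \<iota>\<close> along the first \<open>n\<close> letters of \<open>\<omega>\<close> takes the unit interval to
  the cell with left end \<open>cell_left R V \<omega> n\<close> and length \<open>cell_size R \<omega> n\<close>.
\<close>

lemma cell_size_0 [simp]: "cell_size R \<omega> 0 = 1"
  and cell_size_Suc: "cell_size R \<omega> (Suc n) = cell_size R \<omega> n * R (\<omega> n)"
  and cell_left_0 [simp]: "cell_left R V \<omega> 0 = 0"
  and cell_left_Suc: "cell_left R V \<omega> (Suc n) = cell_left R V \<omega> n + cell_size R \<omega> n * V (\<omega> n)"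
  by (simp_all add: cell_size_def cell_left_def)

lemma cell_size_cong: "(\<And>l. l < n \<Longrightarrow> R (\<omega> l) = R (\<omega>' l)) \<Longrightarrow> cell_size R \<omega> n = cell_size R \<omega>' n"
  by (simp add: cell_size_def)

lemma cell_left_cong:
  assumes "\<And>l. l < n \<Longrightarrow> R (\<omega> l) = R (\<omega>' l) \<and> V (\<omega> l) = V (\<omega>' l)"
  shows "cell_left R V \<omega> n = cell_left R V \<omega>' n"
  unfolding cell_left_def using assms
  by (intro sum.cong refl arg_cong2[where f = "(*)"] cell_size_cong) auto

lemma cell_size_nonneg: "(\<And>l. 0 \<le> R (\<omega> l)) \<Longrightarrow> 0 \<le> cell_size R \<omega> n"
  by (simp add: cell_size_def prod_nonneg)

lemma cell_size_le_powr:
  assumes "\<And>l. 0 \<le> R' (\<omega> l)" "\<And>l. 0 < R (\<omega> l)" "\<And>l. R' (\<omega> l) \<le> R (\<omega> l) powr \<theta>"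
  shows "cell_size R' \<omega> n \<le> cell_size R \<omega> n powr \<theta>"
proof (induction n)
  case (Suc n)
  have "cell_size R' \<omega> n * R' (\<omega> n) \<le> cell_size R \<omega> n powr \<theta> * R (\<omega> n) powr \<theta>"
    using Suc assms by (intro mult_mono) auto
  also have "\<dots> = (cell_size R \<omega> n * R (\<omega> n)) powr \<theta>"
    using assms(2) by (subst powr_mult) (auto intro: cell_size_nonneg less_imp_le)
  finally show ?case by (simp add: cell_size_Suc)
qed simp

text \<open>
  A letter acts on the line only through its \<open>digit\<close>; different letters may have the same digit
  and then have the same cell. The margin \<open>\<kappa>\<close> from \<open>0\<close> controls how far a cell can overshoot
  at the stopping time, the margin from \<open>1\<close> makes the stopping time finite.
\<close>

locale line_coding =
  fixes I :: "'l set" and R V :: "'l \<Rightarrow> real" and digit :: "'l \<Rightarrow> 'b" and \<kappa> :: real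
  assumes kappa_pos: "0 < \<kappa>"
    and R_ge: "\<iota> \<in> I \<Longrightarrow> \<kappa> \<le> R \<iota>" and R_le: "\<iota> \<in> I \<Longrightarrow> R \<iota> \<le> 1 - \<kappa>"
    and V_ge: "\<iota> \<in> I \<Longrightarrow> 0 \<le> V \<iota>" and VR_le: "\<iota> \<in> I \<Longrightarrow> V \<iota> + R \<iota> \<le> 1"
    and R_cong: "digit \<iota> = digit \<iota>' \<Longrightarrow> R \<iota> = R \<iota>'"
    and V_cong: "digit \<iota> = digit \<iota>' \<Longrightarrow> V \<iota> = V \<iota>'"
begin

context
  fixes \<omega> :: "nat \<Rightarrow> 'l"
  assumes \<omega>: "\<And>l. \<omega> l \<in> I"
begin

lemma R_pos: "0 < R (\<omega> l)"
  using kappa_pos R_ge[OF \<omega>, of l] by linarith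

lemma cell_size_pos: "0 < cell_size R \<omega> n"
  by (simp add: cell_size_def prod_pos R_pos)

lemma stop_time_works:
  assumes "0 < r"
  shows "cell_size R \<omega> (stop_time R r \<omega>) \<le> r"
proof -
  have \<kappa>: "\<kappa> \<le> 1 - \<kappa>" using R_ge[OF \<omega>, of 0] R_le[OF \<omega>, of 0] by linarith
  have bound: "cell_size R \<omega> n \<le> (1 - \<kappa>) ^ n" for n
  proof (induction n)
    case (Suc n)
    then show ?case
      using R_le[OF \<omega>, of n] R_pos[of n] cell_size_pos[of n] \<kappa> kappa_pos
      by (auto simp: cell_size_Suc mult.commute intro!: mult_mono)
  qed simp
  obtain n where "(1 - \<kappa>) ^ n < r"
    using real_arch_pow_inv[of r "1 - \<kappa>"] assms kappa_pos by auto
  with bound[of n] have "cell_size R \<omega> n \<le> r" by simp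
  then show ?thesis unfolding stop_time_def by (rule LeastI)
qed

lemma cell_size_before_stop_time: "n < stop_time R r \<omega> \<Longrightarrow> r < cell_size R \<omega> n"
  unfolding stop_time_def using not_less_Least by (metis not_le)

lemma cell_size_stop_time_ge:
  assumes "0 < r" "r \<le> 1"
  shows "\<kappa> * r \<le> cell_size R \<omega> (stop_time R r \<omega>)"
proof (cases "stop_time R r \<omega>")
  case 0
  have "\<kappa> \<le> 1" using R_ge[OF \<omega>, of 0] R_le[OF \<omega>, of 0] kappa_pos by linarith
  then show ?thesis using 0 assms kappa_pos by (simp add: mult_le_one)
next
  case (Suc n)
  then have "r < cell_size R \<omega> n" using cell_size_before_stop_time[of n r] by simp
  then have "r * \<kappa> \<le> cell_size R \<omega> n * R (\<omega> n)"
    using assms kappa_pos R_ge[OF \<omega>] by (intro mult_mono) auto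
  then show ?thesis by (simp add: Suc cell_size_Suc mult.commute)
qed

lemma cells_nested:
  assumes "n \<le> n'"
  shows "cell_left R V \<omega> n \<le> cell_left R V \<omega> n' \<and>
    cell_left R V \<omega> n' + cell_size R \<omega> n' \<le> cell_left R V \<omega> n + cell_size R \<omega> n"
  using assms
proof (induction n' rule: dec_induct)
  case (step k)
  have "0 \<le> cell_size R \<omega> k * V (\<omega> k)"
    using cell_size_pos[of k] V_ge[OF \<omega>, of k] by simp
  moreover have "cell_size R \<omega> k * (V (\<omega> k) + R (\<omega> k)) \<le> cell_size R \<omega> k * 1"
    using cell_size_pos[of k] VR_le[OF \<omega>, of k] by (intro mult_left_mono) auto
  ultimately show ?case
    using step.IH by (simp add: cell_size_Suc cell_left_Suc algebra_simps)
qed simp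

end

text \<open>
  Two cells that split at step \<open>l\<close> lie in different children of a common parent, so one lies
  entirely to the left of the other and their left ends differ by at least the size of a cell,
  which is at least \<open>\<kappa> * r\<close> at the stopping time.
\<close>

lemma cells_close_imp_equal:
  assumes \<omega>: "\<And>l. \<omega> l \<in> I" and \<omega>': "\<And>l. \<omega>' l \<in> I"
    and r: "0 < r" "r \<le> 1"
    and split: "\<And>l. l < stop_time R r \<omega> \<Longrightarrow> digit (\<omega> l) \<noteq> digit (\<omega>' l) \<Longrightarrow>
      V (\<omega> l) + R (\<omega> l) \<le> V (\<omega>' l) \<or> V (\<omega>' l) + R (\<omega>' l) \<le> V (\<omega> l)"
    and close: "\<bar>cell_left R V \<omega> (stop_time R r \<omega>) - cell_left R V \<omega>' (stop_time R r \<omega>')\<bar> < \<kappa> * r"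
    and l: "l < stop_time R r \<omega>"
  shows "digit (\<omega> l) = digit (\<omega>' l)"
proof (rule ccontr)
  assume "digit (\<omega> l) \<noteq> digit (\<omega>' l)"
  define k where "k = (LEAST l. digit (\<omega> l) \<noteq> digit (\<omega>' l))"
  have k: "digit (\<omega> k) \<noteq> digit (\<omega>' k)"
    unfolding k_def by (rule LeastI) fact
  have before: "digit (\<omega> j) = digit (\<omega>' j)" if "j < k" for j
    using not_less_Least[of j "\<lambda>l. digit (\<omega> l) \<noteq> digit (\<omega>' l)"] that by (simp add: k_def)
  have kl: "k \<le> l" unfolding k_def by (rule Least_le) fact
  let ?T = "stop_time R r \<omega>" and ?T' = "stop_time R r \<omega>'"
  have kT: "k < ?T" using kl l by simp
  have kT': "k < ?T'"
  proof (rule ccontr)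
    assume "\<not> k < ?T'"
    then have "cell_size R \<omega> ?T' = cell_size R \<omega>' ?T'"
      by (intro cell_size_cong R_cong before) simp
    then have "cell_size R \<omega> ?T' \<le> r" using stop_time_works[where \<omega> = \<omega>', OF \<omega>' r(1)] by simp
    then have "?T \<le> ?T'" unfolding stop_time_def[of R r \<omega>] by (rule Least_le)
    with \<open>\<not> k < ?T'\<close> kT show False by simp
  qed
  have same: "cell_left R V \<omega> k = cell_left R V \<omega>' k" "cell_size R \<omega> k = cell_size R \<omega>' k"
    by (intro cell_left_cong cell_size_cong conjI R_cong V_cong before; assumption)+
  have sep: "cell_left R V x (stop_time R r x) + \<kappa> * r \<le> cell_left R V y (stop_time R r y)"
    if x: "\<And>l. x l \<in> I" and y: "\<And>l. y l \<in> I" and kx: "k < stop_time R r x" and ky: "k < stop_time R r y"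
      and eq: "cell_left R V x k = cell_left R V y k" "cell_size R x k = cell_size R y k"
      and lt: "V (x k) + R (x k) \<le> V (y k)" for x y
  proof -
    have "cell_left R V x (stop_time R r x) + \<kappa> * r
        \<le> cell_left R V x (stop_time R r x) + cell_size R x (stop_time R r x)"
      using cell_size_stop_time_ge[where \<omega> = x, OF x r] by simp
    also have "\<dots> \<le> cell_left R V x (Suc k) + cell_size R x (Suc k)"
      using cells_nested[where \<omega> = x, OF x, of "Suc k" "stop_time R r x"] kx by simp
    also have "\<dots> = cell_left R V x k + cell_size R x k * (V (x k) + R (x k))"
      by (simp add: cell_left_Suc cell_size_Suc algebra_simps)
    also have "\<dots> \<le> cell_left R V y k + cell_size R y k * V (y k)"
      unfolding eq using lt cell_size_pos[where \<omega> = y and n = k, OF y] by (intro add_left_mono mult_left_mono) auto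
    also have "\<dots> = cell_left R V y (Suc k)" by (simp add: cell_left_Suc)
    also have "\<dots> \<le> cell_left R V y (stop_time R r y)"
      using cells_nested[where \<omega> = y, OF y, of "Suc k" "stop_time R r y"] ky by simp
    finally show ?thesis .
  qed
  from split[OF kT k] show False
  proof
    assume "V (\<omega> k) + R (\<omega> k) \<le> V (\<omega>' k)"
    from sep[where x = \<omega> and y = \<omega>', OF \<omega> \<omega>' kT kT' same this] close show False by linarith
  next
    assume "V (\<omega>' k) + R (\<omega>' k) \<le> V (\<omega> k)"
    from sep[where x = \<omega>' and y = \<omega>, OF \<omega>' \<omega> kT' kT same[symmetric] this] close show False by linarith
  qed
qed

end


section \<open>Coordinates of a sponge\<close>

text \<open>
  The digits on which the \<open>d\<close>-th coordinate of the maps depends, the others being blanked out: only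
  \<open>i\<close> for the third coordinate, \<open>(i, j)\<close> for the second, all three for the first.
\<close>

definition digits :: "3 \<Rightarrow> nat \<times> nat \<times> nat \<Rightarrow> nat \<times> nat \<times> nat" where
  "digits d = (\<lambda>(i, j, k). (i, if d = 3 then 0 else j, if d = 1 then k else 0))"

definition ratio :: "sponge_data \<Rightarrow> 3 \<Rightarrow> nat \<times> nat \<times> nat \<Rightarrow> real" where
  "ratio D d = (\<lambda>(i, j, k). if d = 1 then len3 D i j k else if d = 2 then len2 D i j else len1 D i)"

definition offset :: "sponge_data \<Rightarrow> 3 \<Rightarrow> nat \<times> nat \<times> nat \<Rightarrow> real" where
  "offset D d = (\<lambda>(i, j, k). if d = 1 then pos3 D i j k else if d = 2 then pos2 D i j else pos1 D i)"

abbreviation coord_size :: "sponge_data \<Rightarrow> 3 \<Rightarrow> (nat \<Rightarrow> nat \<times> nat \<times> nat) \<Rightarrow> nat \<Rightarrow> real" where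
  "coord_size D d \<equiv> cell_size (ratio D d)"

abbreviation coord_left :: "sponge_data \<Rightarrow> 3 \<Rightarrow> (nat \<Rightarrow> nat \<times> nat \<times> nat) \<Rightarrow> nat \<Rightarrow> real" where
  "coord_left D d \<equiv> cell_left (ratio D d) (offset D d)"

abbreviation coord_stop :: "sponge_data \<Rightarrow> 3 \<Rightarrow> real \<Rightarrow> (nat \<Rightarrow> nat \<times> nat \<times> nat) \<Rightarrow> nat" where
  "coord_stop D d \<equiv> stop_time (ratio D d)"

lemma sponge_map_nth: "sponge_map D \<iota> p $ d = ratio D d \<iota> * p $ d + offset D d \<iota>"
  using exhaust_3[of d] by (cases \<iota>) (auto simp: sponge_map_def ratio_def offset_def)

lemma ratio_digits_cong: "digits d \<iota> = digits d \<iota>' \<Longrightarrow> ratio D d \<iota> = ratio D d \<iota>'"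
  and offset_digits_cong: "digits d \<iota> = digits d \<iota>' \<Longrightarrow> offset D d \<iota> = offset D d \<iota>'"
  using exhaust_3[of d] by (cases \<iota>; cases \<iota>'; auto simp: digits_def ratio_def offset_def)+

lemma finite_alphabet: "finite (alphabet m m1 m2)"
proof -
  have "alphabet m m1 m2 = (SIGMA i:{1..m}. SIGMA j:{1..m1 i}. {1..m2 i j})"
    by (auto simp: alphabet_def)
  then show ?thesis by (simp add: finite_SigmaI)
qed

lemma admissible_interval_bounds:
  assumes "admissible_intervals n r v" "i \<in> {1..n}"
  shows "0 < r i" "r i < 1" "0 \<le> v i" "v i + r i \<le> 1"
proof -
  show "0 < r i" "r i < 1" "0 \<le> v i"
    using assms by (auto simp: admissible_intervals_def)
  have "(if i = n then 1 else v (i + 1)) - v i \<ge> r i"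
    using assms by (auto simp: admissible_intervals_def)
  moreover have "v (i + 1) < 1" if "i \<noteq> n"
    using assms that by (auto simp: admissible_intervals_def)
  ultimately show "v i + r i \<le> 1" by (auto split: if_splits)
qed

lemma admissible_intervals_disjoint:
  assumes adm: "admissible_intervals n r v" and "i \<in> {1..n}" "i' \<in> {1..n}" "i < i'"
  shows "v i + r i \<le> v i'"
proof -
  have "(if i = n then 1 else v (i + 1)) - v i \<ge> r i"
    using adm assms(2) unfolding admissible_intervals_def by blast
  moreover have "i \<noteq> n" using assms by auto
  moreover have "v (i + 1) \<le> v i'"
    using assms by (intro strict_mono_on_leD[of "{1..n}" v]) (auto simp: admissible_intervals_def)
  ultimately show ?thesis by auto
qed

lemma admissible_data_intervals:
  assumes "admissible_data m m1 m2 D" "(i, j, k) \<in> alphabet m m1 m2"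
  shows "admissible_intervals m (len1 D) (pos1 D)" "i \<in> {1..m}"
    "admissible_intervals (m1 i) (len2 D i) (pos2 D i)" "j \<in> {1..m1 i}"
    "admissible_intervals (m2 i j) (len3 D i j) (pos3 D i j)" "k \<in> {1..m2 i j}"
proof -
  have "(i, j) \<in> alphabet_proj m m1 m2" using assms(2) by (auto simp: alphabet_proj_def)
  then show "admissible_intervals (m2 i j) (len3 D i j) (pos3 D i j)"
    using assms(1) by (auto simp: admissible_data_def)
  show "admissible_intervals m (len1 D) (pos1 D)" "i \<in> {1..m}"
    "admissible_intervals (m1 i) (len2 D i) (pos2 D i)" "j \<in> {1..m1 i}" "k \<in> {1..m2 i j}"
    using assms by (auto simp: admissible_data_def alphabet_def)
qed

lemma admissible_data_coordinate:
  assumes "admissible_data m m1 m2 D" "\<iota> \<in> alphabet m m1 m2"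
  shows "0 < ratio D d \<iota>" "ratio D d \<iota> < 1" "0 \<le> offset D d \<iota>" "offset D d \<iota> + ratio D d \<iota> \<le> 1"
proof -
  obtain i j k where \<iota>: "\<iota> = (i, j, k)" by (cases \<iota>)
  note adm = admissible_data_intervals[OF assms[unfolded \<iota>]]
  note bounds = admissible_interval_bounds[OF adm(1,2)] admissible_interval_bounds[OF adm(3,4)]
    admissible_interval_bounds[OF adm(5,6)]
  show "0 < ratio D d \<iota>" "ratio D d \<iota> < 1" "0 \<le> offset D d \<iota>" "offset D d \<iota> + ratio D d \<iota> \<le> 1"
    using bounds by (auto simp: \<iota> ratio_def offset_def)
qed

lemma ratio_decreasing:
  assumes "admissible_data m m1 m2 D" "\<iota> \<in> alphabet m m1 m2"
  shows "ratio D 1 \<iota> \<le> ratio D 2 \<iota>" "ratio D 2 \<iota> \<le> ratio D 3 \<iota>"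
proof -
  obtain i j k where \<iota>: "\<iota> = (i, j, k)" by (cases \<iota>)
  have "len3 D i j k \<le> len2 D i j \<and> len2 D i j \<le> len1 D i"
    using assms unfolding admissible_data_def \<iota> by blast
  then show "ratio D 1 \<iota> \<le> ratio D 2 \<iota>" "ratio D 2 \<iota> \<le> ratio D 3 \<iota>"
    by (simp_all add: \<iota> ratio_def)
qed

text \<open>
  The second coordinates of letters that differ in \<open>j\<close> can only be compared when the letters agree in
  \<open>i\<close>, and likewise for the first coordinate.
\<close>

lemma coordinate_split:
  assumes adm: "admissible_data m m1 m2 D"
    and I: "\<iota> \<in> alphabet m m1 m2" "\<iota>' \<in> alphabet m m1 m2"
    and neq: "digits d \<iota> \<noteq> digits d \<iota>'"
    and coarser: "d \<noteq> 3 \<Longrightarrow> digits 3 \<iota> = digits 3 \<iota>'" "d = 1 \<Longrightarrow> digits 2 \<iota> = digits 2 \<iota>'"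
  shows "offset D d \<iota> + ratio D d \<iota> \<le> offset D d \<iota>' \<or> offset D d \<iota>' + ratio D d \<iota>' \<le> offset D d \<iota>"
proof -
  obtain i j k i' j' k' where eq: "\<iota> = (i, j, k)" "\<iota>' = (i', j', k')" by (cases \<iota>; cases \<iota>')
  note A = admissible_data_intervals[OF adm I(1)[unfolded eq]]
  note A' = admissible_data_intervals[OF adm I(2)[unfolded eq]]
  consider "d = 1" | "d = 2" | "d = 3" using exhaust_3[of d] by auto
  then show ?thesis
  proof cases
    case 1
    then have ij: "i = i'" "j = j'" "k \<noteq> k'" using neq coarser by (auto simp: eq digits_def)
    from ij consider "k < k'" | "k' < k" by linarith
    then show ?thesis
    proof cases
      case 1
      then show ?thesis
        using admissible_intervals_disjoint[OF A(5), of k k'] A(6) A'(6) ij \<open>d = 1\<close>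
        by (simp add: eq offset_def ratio_def)
    next
      case 2
      then show ?thesis
        using admissible_intervals_disjoint[OF A(5), of k' k] A(6) A'(6) ij \<open>d = 1\<close>
        by (simp add: eq offset_def ratio_def)
    qed
  next
    case 2
    then have ij: "i = i'" "j \<noteq> j'" using neq coarser by (auto simp: eq digits_def)
    from ij consider "j < j'" | "j' < j" by linarith
    then show ?thesis
    proof cases
      case 1
      then show ?thesis
        using admissible_intervals_disjoint[OF A(3), of j j'] A(4) A'(4) ij \<open>d = 2\<close>
        by (simp add: eq offset_def ratio_def)
    next
      case 2
      then show ?thesis
        using admissible_intervals_disjoint[OF A(3), of j' j] A(4) A'(4) ij \<open>d = 2\<close>
        by (simp add: eq offset_def ratio_def)
    qed
  next
    case 3
    then have ij: "i \<noteq> i'" using neq by (auto simp: eq digits_def)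
    from ij consider "i < i'" | "i' < i" by linarith
    then show ?thesis
    proof cases
      case 1
      then show ?thesis
        using admissible_intervals_disjoint[OF A(1), of i i'] A(2) A'(2) ij \<open>d = 3\<close>
        by (simp add: eq offset_def ratio_def)
    next
      case 2
      then show ?thesis
        using admissible_intervals_disjoint[OF A(1), of i' i] A(2) A'(2) ij \<open>d = 3\<close>
        by (simp add: eq offset_def ratio_def)
    qed
  qed
qed

lemma admissible_data_line_coding:
  assumes "admissible_data m m1 m2 D"
  obtains \<kappa> where "\<And>d. line_coding (alphabet m m1 m2) (ratio D d) (offset D d) (digits d) \<kappa>"
proof -
  define X where "X = (\<lambda>(d, \<iota>). min (ratio D d \<iota>) (1 - ratio D d \<iota>)) ` (UNIV \<times> alphabet m m1 m2)"
  define \<kappa> where "\<kappa> = Min (insert 1 X)"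
  have X: "finite X" by (simp add: X_def finite_alphabet)
  have pos: "0 < x" if "x \<in> insert 1 X" for x
    using that admissible_data_coordinate(1,2)[OF assms] by (auto simp: X_def)
  have \<kappa>_le: "\<kappa> \<le> min (ratio D d \<iota>) (1 - ratio D d \<iota>)" if "\<iota> \<in> alphabet m m1 m2" for d \<iota>
    unfolding \<kappa>_def using X that by (intro Min_le) (auto simp: X_def)
  have "line_coding (alphabet m m1 m2) (ratio D d) (offset D d) (digits d) \<kappa>" for d
  proof
    show "0 < \<kappa>" unfolding \<kappa>_def by (rule pos, rule Min_in) (use X in auto)
    show "\<kappa> \<le> ratio D d \<iota>" "ratio D d \<iota> \<le> 1 - \<kappa>" if "\<iota> \<in> alphabet m m1 m2" for \<iota>
      using \<kappa>_le[OF that, of d] by auto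
    show "0 \<le> offset D d \<iota>" "offset D d \<iota> + ratio D d \<iota> \<le> 1" if "\<iota> \<in> alphabet m m1 m2" for \<iota>
      by (rule admissible_data_coordinate[OF assms that])+
    show "ratio D d \<iota> = ratio D d \<iota>'" "offset D d \<iota> = offset D d \<iota>'" if "digits d \<iota> = digits d \<iota>'" for \<iota> \<iota>'
      by (rule ratio_digits_cong[OF that], rule offset_digits_cong[OF that])
  qed
  then show ?thesis by (rule that)
qed


section \<open>Addresses of points\<close>

definition addressed :: "sponge_data \<Rightarrow> (real^3) set \<Rightarrow> (nat \<Rightarrow> nat \<times> nat \<times> nat) \<Rightarrow> real^3 \<Rightarrow> bool" where
  "addressed D \<Lambda> \<omega> p \<longleftrightarrow> (\<forall>n. \<exists>q\<in>\<Lambda>. \<forall>d. p $ d = coord_left D d \<omega> n + coord_size D d \<omega> n * q $ d)"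

text \<open>
  At a point where a coordinate is extremal, the self-affinity \<open>p = A q\<close> compares the extremal value
  with its own image under a contraction of the unit interval.
\<close>

lemma self_affine_sponge_unit_cube:
  assumes sponge: "self_affine_sponge m m1 m2 D \<Lambda>" and p: "p \<in> \<Lambda>"
  shows "0 \<le> p $ d \<and> p $ d \<le> 1"
proof -
  have adm: "admissible_data m m1 m2 D" and cpt: "compact \<Lambda>" and ne: "\<Lambda> \<noteq> {}"
    and fixed: "\<Lambda> = (\<Union>\<iota>\<in>alphabet m m1 m2. sponge_map D \<iota> ` \<Lambda>)"
    using sponge by (auto simp: self_affine_sponge_def)
  have pre: "\<exists>\<iota>\<in>alphabet m m1 m2. \<exists>q\<in>\<Lambda>. x = sponge_map D \<iota> q" if "x \<in> \<Lambda>" for x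
    using that by (subst (asm) fixed) auto
  have cont: "continuous_on \<Lambda> (\<lambda>p. p $ d)" by (intro continuous_intros)
  obtain x where x: "x \<in> \<Lambda>" "\<And>y. y \<in> \<Lambda> \<Longrightarrow> y $ d \<le> x $ d"
    using continuous_attains_sup[OF cpt ne cont] by blast
  obtain z where z: "z \<in> \<Lambda>" "\<And>y. y \<in> \<Lambda> \<Longrightarrow> z $ d \<le> y $ d"
    using continuous_attains_inf[OF cpt ne cont] by blast
  have "x $ d \<le> 1"
  proof -
    obtain \<iota> q where q: "\<iota> \<in> alphabet m m1 m2" "q \<in> \<Lambda>" "x = sponge_map D \<iota> q" using pre[OF x(1)] by blast
    note R = admissible_data_coordinate[OF adm q(1), of d]
    have "x $ d \<le> ratio D d \<iota> * x $ d + offset D d \<iota>"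
      using x(2)[OF q(2)] R(1) by (subst q(3)) (simp add: sponge_map_nth)
    then have "(1 - ratio D d \<iota>) * x $ d \<le> (1 - ratio D d \<iota>) * 1"
      using R(4) by (simp add: algebra_simps)
    then show ?thesis using R(2) by (simp add: mult_le_cancel_left_pos)
  qed
  moreover have "0 \<le> z $ d"
  proof -
    obtain \<iota> q where q: "\<iota> \<in> alphabet m m1 m2" "q \<in> \<Lambda>" "z = sponge_map D \<iota> q" using pre[OF z(1)] by blast
    note R = admissible_data_coordinate[OF adm q(1), of d]
    have "ratio D d \<iota> * z $ d + offset D d \<iota> \<le> z $ d"
      using z(2)[OF q(2)] R(1) by (subst (2) q(3)) (simp add: sponge_map_nth)
    then have "0 \<le> (1 - ratio D d \<iota>) * z $ d"
      using R(3) by (simp add: algebra_simps)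
    then show ?thesis using R(2) by (simp add: zero_le_mult_iff)
  qed
  ultimately show ?thesis using x(2)[OF p] z(2)[OF p] by linarith
qed

lemma address_exists:
  assumes sponge: "self_affine_sponge m m1 m2 D \<Lambda>" and p: "p \<in> \<Lambda>"
  obtains \<omega> where "\<forall>l. \<omega> l \<in> alphabet m m1 m2" "addressed D \<Lambda> \<omega> p"
proof -
  have "\<Lambda> = (\<Union>\<iota>\<in>alphabet m m1 m2. sponge_map D \<iota> ` \<Lambda>)"
    using sponge by (auto simp: self_affine_sponge_def)
  then have "\<forall>x\<in>\<Lambda>. \<exists>\<iota> q. \<iota> \<in> alphabet m m1 m2 \<and> q \<in> \<Lambda> \<and> x = sponge_map D \<iota> q" by blast
  then obtain first rest where step: "\<And>x. x \<in> \<Lambda> \<Longrightarrow>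
      first x \<in> alphabet m m1 m2 \<and> rest x \<in> \<Lambda> \<and> x = sponge_map D (first x) (rest x)"
    by metis
  define tail where "tail n = (rest ^^ n) p" for n
  define \<omega> where "\<omega> n = first (tail n)" for n
  have tail: "tail n \<in> \<Lambda>" for n
    unfolding tail_def using p step by (induction n) auto
  have "p $ d = coord_left D d \<omega> n + coord_size D d \<omega> n * tail n $ d" for n d
  proof (induction n)
    case 0 then show ?case by (simp add: tail_def)
  next
    case (Suc n)
    have "tail n = sponge_map D (\<omega> n) (tail (Suc n))"
      using step[OF tail[of n]] by (simp add: \<omega>_def tail_def)
    then have "tail n $ d = ratio D d (\<omega> n) * tail (Suc n) $ d + offset D d (\<omega> n)"
      by (metis sponge_map_nth)
    with Suc show ?case by (simp add: cell_left_Suc cell_size_Suc algebra_simps)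
  qed
  then have "addressed D \<Lambda> \<omega> p" unfolding addressed_def using tail by blast
  moreover have "\<omega> l \<in> alphabet m m1 m2" for l using step[OF tail] by (simp add: \<omega>_def)
  ultimately show ?thesis using that by blast
qed

text \<open>The images of \<open>\<Lambda>\<close> under the initial segments of \<open>\<omega>\<close> are nested compact sets.\<close>

lemma addressed_point_exists:
  assumes sponge: "self_affine_sponge m m1 m2 D \<Lambda>" and \<omega>: "\<And>l. \<omega> l \<in> alphabet m m1 m2"
  obtains p where "p \<in> \<Lambda>" "addressed D \<Lambda> \<omega> p"
proof -
  have cpt: "compact \<Lambda>" and ne: "\<Lambda> \<noteq> {}"
    and fixed: "\<Lambda> = (\<Union>\<iota>\<in>alphabet m m1 m2. sponge_map D \<iota> ` \<Lambda>)"
    using sponge by (auto simp: self_affine_sponge_def)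
  define A where "A n q = (\<chi> d. coord_left D d \<omega> n + coord_size D d \<omega> n * q $ d)" for n and q :: "real^3"
  have "A (Suc n) ` \<Lambda> \<subseteq> A n ` \<Lambda>" for n
  proof
    fix x assume "x \<in> A (Suc n) ` \<Lambda>"
    then obtain q where q: "q \<in> \<Lambda>" "x = A (Suc n) q" by blast
    have "x = A n (sponge_map D (\<omega> n) q)"
      by (simp add: q(2) A_def vec_eq_iff sponge_map_nth cell_left_Suc cell_size_Suc algebra_simps)
    moreover have "sponge_map D (\<omega> n) q \<in> \<Lambda>" using \<omega> q(1) by (subst fixed) blast
    ultimately show "x \<in> A n ` \<Lambda>" by blast
  qed
  then have "A n ` \<Lambda> \<subseteq> A k ` \<Lambda>" if "k \<le> n" for k n
    using that by (rule lift_Suc_antimono_le)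
  moreover have "compact (A n ` \<Lambda>)" for n
    unfolding A_def using cpt by (intro compact_continuous_image continuous_intros)
  ultimately have "\<Inter>(range (\<lambda>n. A n ` \<Lambda>)) \<noteq> {}"
    using ne by (intro compact_nest) auto
  then obtain p where p: "\<And>n. p \<in> A n ` \<Lambda>" by auto
  have "A 0 q = q" for q by (simp add: A_def vec_eq_iff)
  then have "p \<in> \<Lambda>" using p[of 0] by auto
  moreover have "addressed D \<Lambda> \<omega> p"
    unfolding addressed_def using p by (fastforce simp: A_def)
  ultimately show ?thesis by (rule that)
qed


section \<open>Approximate cubes\<close>

text \<open>
  For \<open>0 < r \<le> 1\<close> the sequences that share with \<open>\<omega>\<close>, for every \<open>d\<close>, the \<open>d\<close>-digits up to the \<open>d\<close>-th
  stopping time at scale \<open>r\<close> form the approximate cube of \<open>\<omega>\<close>: if all ratios are at least \<open>\<kappa>\<close>, the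
  sides of its box have lengths between \<open>\<kappa> * r\<close> and \<open>r\<close>. Such boxes are so large that the grid point below their lowest corner on a grid of
  mesh \<open>\<kappa> * r\<close> identifies them, see \<open>cube_code_determines_digits\<close>; this turns counting approximate
  cubes into counting integer points.
\<close>

definition cube_code :: "sponge_data \<Rightarrow> real \<Rightarrow> real \<Rightarrow> (nat \<Rightarrow> nat \<times> nat \<times> nat) \<Rightarrow> 3 \<Rightarrow> int" where
  "cube_code D \<kappa> r \<omega> d = \<lfloor>coord_left D d \<omega> (coord_stop D d r \<omega>) / (\<kappa> * r)\<rfloor>"

lemma coord_stop_mono:
  assumes adm: "admissible_data m m1 m2 D" and \<omega>: "\<And>l. \<omega> l \<in> alphabet m m1 m2" and r: "0 < r"
  shows "coord_stop D 1 r \<omega> \<le> coord_stop D 2 r \<omega>" "coord_stop D 2 r \<omega> \<le> coord_stop D 3 r \<omega>"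
proof -
  obtain \<kappa> where lc: "\<And>d. line_coding (alphabet m m1 m2) (ratio D d) (offset D d) (digits d) \<kappa>"
    using admissible_data_line_coding[OF adm] by blast
  have step: "coord_stop D d r \<omega> \<le> coord_stop D e r \<omega>" if le: "\<And>l. ratio D d (\<omega> l) \<le> ratio D e (\<omega> l)" for d e
  proof -
    have "coord_size D d \<omega> (coord_stop D e r \<omega>) \<le> coord_size D e \<omega> (coord_stop D e r \<omega>)"
      unfolding cell_size_def
      by (intro prod_mono conjI le less_imp_le[OF admissible_data_coordinate(1)[OF adm \<omega>]])
    also have "\<dots> \<le> r" by (rule line_coding.stop_time_works[where \<omega> = \<omega>, OF lc \<omega> r])
    finally show ?thesis unfolding stop_time_def[of "ratio D d"] by (rule Least_le)
  qed
  show "coord_stop D 1 r \<omega> \<le> coord_stop D 2 r \<omega>" "coord_stop D 2 r \<omega> \<le> coord_stop D 3 r \<omega>"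
    by (rule step, rule ratio_decreasing[OF adm \<omega>])+
qed

text \<open>
  The digits are recovered coordinate by coordinate from the third to the first: cells of the
  \<open>d\<close>-th coordinate are disjoint only among sequences with the same coarser digits, and these are
  already known to agree for long enough because \<open>a\<^sub>i\<^sub>j\<^sub>k \<le> b\<^sub>i\<^sub>j \<le> c\<^sub>i\<close> makes the stopping times of finer
  coordinates shorter.
\<close>

lemma cube_code_determines_digits:
  assumes adm: "admissible_data m m1 m2 D"
    and lc: "\<And>d. line_coding (alphabet m m1 m2) (ratio D d) (offset D d) (digits d) \<kappa>"
    and \<omega>: "\<And>l. \<omega> l \<in> alphabet m m1 m2" and \<omega>': "\<And>l. \<omega>' l \<in> alphabet m m1 m2"
    and r: "0 < r" "r \<le> 1"
    and code: "cube_code D \<kappa> r \<omega> = cube_code D \<kappa> r \<omega>'"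
    and l: "l < coord_stop D d r \<omega>"
  shows "digits d (\<omega> l) = digits d (\<omega>' l)"
proof -
  have close: "\<bar>coord_left D d \<omega> (coord_stop D d r \<omega>) - coord_left D d \<omega>' (coord_stop D d r \<omega>')\<bar> < \<kappa> * r" for d
  proof -
    have pos: "0 < \<kappa> * r" using line_coding.kappa_pos[OF lc] r by simp
    have "\<lfloor>coord_left D d \<omega> (coord_stop D d r \<omega>) / (\<kappa> * r)\<rfloor> = \<lfloor>coord_left D d \<omega>' (coord_stop D d r \<omega>') / (\<kappa> * r)\<rfloor>"
      using fun_cong[OF code, of d] by (simp add: cube_code_def)
    then have "\<bar>coord_left D d \<omega> (coord_stop D d r \<omega>) / (\<kappa> * r) - coord_left D d \<omega>' (coord_stop D d r \<omega>') / (\<kappa> * r)\<bar> < 1"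
      by linarith
    then have "\<bar>coord_left D d \<omega> (coord_stop D d r \<omega>) - coord_left D d \<omega>' (coord_stop D d r \<omega>')\<bar> / (\<kappa> * r) < 1"
      using pos by (simp add: abs_divide flip: diff_divide_distrib)
    then show ?thesis using pos by (simp add: pos_divide_less_eq)
  qed
  have step: "digits d (\<omega> l) = digits d (\<omega>' l)"
    if coarser: "\<And>l. l < coord_stop D d r \<omega> \<Longrightarrow> d \<noteq> 3 \<Longrightarrow> digits 3 (\<omega> l) = digits 3 (\<omega>' l)"
        "\<And>l. l < coord_stop D d r \<omega> \<Longrightarrow> d = 1 \<Longrightarrow> digits 2 (\<omega> l) = digits 2 (\<omega>' l)"
      and l: "l < coord_stop D d r \<omega>" for d l
  proof (rule line_coding.cells_close_imp_equal[where \<omega> = \<omega> and \<omega>' = \<omega>', OF lc \<omega> \<omega>' r _ close l])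
    fix l assume "l < coord_stop D d r \<omega>" and "digits d (\<omega> l) \<noteq> digits d (\<omega>' l)"
    then show "offset D d (\<omega> l) + ratio D d (\<omega> l) \<le> offset D d (\<omega>' l) \<or>
        offset D d (\<omega>' l) + ratio D d (\<omega>' l) \<le> offset D d (\<omega> l)"
      by (intro coordinate_split[OF adm \<omega> \<omega>' _ coarser])
  qed
  have 3: "digits 3 (\<omega> l) = digits 3 (\<omega>' l)" if "l < coord_stop D 3 r \<omega>" for l
    by (rule step[OF _ _ that]) auto
  have 2: "digits 2 (\<omega> l) = digits 2 (\<omega>' l)" if "l < coord_stop D 2 r \<omega>" for l
    by (rule step[OF _ _ that]) (use coord_stop_mono(2)[where \<omega> = \<omega>, OF adm \<omega> r(1)] in \<open>auto intro!: 3\<close>)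
  have 1: "digits 1 (\<omega> l) = digits 1 (\<omega>' l)" if "l < coord_stop D 1 r \<omega>" for l
    by (rule step[OF _ _ that]) (use coord_stop_mono[where \<omega> = \<omega>, OF adm \<omega> r(1)] in \<open>auto intro!: 3 2\<close>)
  show ?thesis using exhaust_3[of d] l 1 2 3 by auto
qed

section \<open>Transfer of covers between sponges\<close>

text \<open>
  An approximate cube of the first sponge at scale \<open>r\<close> prescribes, in each coordinate of the second
  sponge, digits whose ratios have a product at most \<open>r powr \<theta>\<close>.
\<close>

lemma same_cube_code_imp_close:
  assumes adm: "admissible_data m m1 m2 D"
    and lc: "\<And>d. line_coding (alphabet m m1 m2) (ratio D d) (offset D d) (digits d) \<kappa>"
    and sponge': "self_affine_sponge m m1 m2 D' \<Lambda>'"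
    and ratios: "\<And>d \<iota>. \<iota> \<in> alphabet m m1 m2 \<Longrightarrow> ratio D' d \<iota> \<le> ratio D d \<iota> powr \<theta>"
    and \<theta>: "0 < \<theta>" and r: "0 < r" "r \<le> 1"
    and \<omega>: "\<And>l. \<omega> l \<in> alphabet m m1 m2" and \<omega>': "\<And>l. \<omega>' l \<in> alphabet m m1 m2"
    and code: "cube_code D \<kappa> r \<omega> = cube_code D \<kappa> r \<omega>'"
    and x: "addressed D' \<Lambda>' \<omega> x" and y: "addressed D' \<Lambda>' \<omega>' y"
  shows "dist x y \<le> 3 * r powr \<theta>"
proof -
  have adm': "admissible_data m m1 m2 D'" using sponge' by (simp add: self_affine_sponge_def)
  have "\<bar>x $ d - y $ d\<bar> \<le> r powr \<theta>" for d
  proof -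
    let ?n = "coord_stop D d r \<omega>"
    obtain p where p: "p \<in> \<Lambda>'" "x $ d = coord_left D' d \<omega> ?n + coord_size D' d \<omega> ?n * p $ d"
      using x unfolding addressed_def by blast
    obtain q where q: "q \<in> \<Lambda>'" "y $ d = coord_left D' d \<omega>' ?n + coord_size D' d \<omega>' ?n * q $ d"
      using y unfolding addressed_def by blast
    have dig: "digits d (\<omega> l) = digits d (\<omega>' l)" if "l < ?n" for l
      by (rule cube_code_determines_digits[where \<omega> = \<omega> and \<omega>' = \<omega>', OF adm lc \<omega> \<omega>' r code that])
    have same: "coord_left D' d \<omega> ?n = coord_left D' d \<omega>' ?n" "coord_size D' d \<omega> ?n = coord_size D' d \<omega>' ?n"
      by (intro cell_left_cong cell_size_cong conjI ratio_digits_cong offset_digits_cong dig; assumption)+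
    have size: "0 \<le> coord_size D' d \<omega> ?n"
      by (intro cell_size_nonneg less_imp_le[OF admissible_data_coordinate(1)[OF adm' \<omega>]])
    have "x $ d - y $ d = coord_size D' d \<omega> ?n * (p $ d - q $ d)"
      unfolding p(2) q(2) same by (simp add: algebra_simps)
    then have "\<bar>x $ d - y $ d\<bar> = coord_size D' d \<omega> ?n * \<bar>p $ d - q $ d\<bar>"
      using size by (simp add: abs_mult)
    also have "\<bar>p $ d - q $ d\<bar> \<le> 1"
      using self_affine_sponge_unit_cube[OF sponge' p(1), of d] self_affine_sponge_unit_cube[OF sponge' q(1), of d]
      by linarith
    then have "coord_size D' d \<omega> ?n * \<bar>p $ d - q $ d\<bar> \<le> coord_size D' d \<omega> ?n"
      using size by (rule mult_left_le)
    also have "\<dots> \<le> coord_size D d \<omega> ?n powr \<theta>"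
      by (intro cell_size_le_powr ratios \<omega> admissible_data_coordinate(1)[OF adm \<omega>]
          less_imp_le[OF admissible_data_coordinate(1)[OF adm' \<omega>]])
    also have "\<dots> \<le> r powr \<theta>"
      using \<theta> line_coding.stop_time_works[where \<omega> = \<omega>, OF lc \<omega> r(1)]
      by (intro powr_mono2 cell_size_nonneg less_imp_le[OF admissible_data_coordinate(1)[OF adm \<omega>]]) auto
    finally show ?thesis .
  qed
  then have "(\<Sum>d\<in>UNIV. \<bar>(x - y) $ d\<bar>) \<le> (\<Sum>d\<in>(UNIV :: 3 set). r powr \<theta>)"
    by (intro sum_mono) simp
  then show ?thesis
    using norm_le_l1_cart[of "x - y"] by (simp add: dist_norm)
qed

text \<open>
  Within distance \<open>r\<close> of \<open>p\<close>, a point lies at most \<open>r\<close> away in each coordinate, and the left end of its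
  cell at most another \<open>r\<close> to the left.
\<close>

lemma cube_code_range:
  assumes sponge: "self_affine_sponge m m1 m2 D \<Lambda>"
    and lc: "\<And>d. line_coding (alphabet m m1 m2) (ratio D d) (offset D d) (digits d) \<kappa>"
    and r: "0 < r" and \<omega>: "\<And>l. \<omega> l \<in> alphabet m m1 m2" and q: "addressed D \<Lambda> \<omega> q" and pq: "dist p q \<le> r"
  shows "cube_code D \<kappa> r \<omega> d \<in> {\<lfloor>(p $ d - 2 * r) / (\<kappa> * r)\<rfloor>..\<lfloor>(p $ d + r) / (\<kappa> * r)\<rfloor>}"
proof -
  have adm: "admissible_data m m1 m2 D" using sponge by (simp add: self_affine_sponge_def)
  let ?n = "coord_stop D d r \<omega>"
  obtain z where z: "z \<in> \<Lambda>" "q $ d = coord_left D d \<omega> ?n + coord_size D d \<omega> ?n * z $ d"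
    using q unfolding addressed_def by blast
  have z1: "0 \<le> z $ d" "z $ d \<le> 1" using self_affine_sponge_unit_cube[OF sponge z(1), of d] by auto
  have size: "0 \<le> coord_size D d \<omega> ?n" "coord_size D d \<omega> ?n \<le> r"
    using line_coding.stop_time_works[where \<omega> = \<omega>, OF lc \<omega> r, of d]
    by (auto intro!: cell_size_nonneg less_imp_le[OF admissible_data_coordinate(1)[OF adm \<omega>]])
  have "0 \<le> coord_size D d \<omega> ?n * z $ d" "coord_size D d \<omega> ?n * z $ d \<le> r * 1"
    using z1 size r by (auto intro!: mult_mono simp del: mult_1_right)
  moreover have "\<bar>p $ d - q $ d\<bar> \<le> r"
    using component_le_norm_cart[of "p - q" d] pq by (simp add: dist_norm)
  ultimately have "p $ d - 2 * r \<le> coord_left D d \<omega> ?n" "coord_left D d \<omega> ?n \<le> p $ d + r"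
    using z(2) by linarith+
  then show ?thesis
    using r line_coding.kappa_pos[OF lc]
    by (auto simp: cube_code_def intro!: floor_mono divide_right_mono)
qed

text \<open>
  Each set of a cover of the first sponge meets boundedly many approximate cubes of its own scale
  \<open>r\<close>; replacing it by the corresponding parts of the second sponge, of diameter at most
  \<open>3 * r powr \<theta>\<close>, multiplies the covering sum by a bounded factor.
\<close>

lemma hausdorff_measure_zero_transfer:
  assumes sponge: "self_affine_sponge m m1 m2 D \<Lambda>" and sponge': "self_affine_sponge m m1 m2 D' \<Lambda>'"
    and ratios: "\<And>d \<iota>. \<iota> \<in> alphabet m m1 m2 \<Longrightarrow> ratio D' d \<iota> \<le> ratio D d \<iota> powr \<theta>"
    and \<theta>: "0 < \<theta>" and s: "0 < s" and null: "hausdorff_measure s \<Lambda> = 0"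
  shows "hausdorff_measure (s / \<theta>) \<Lambda>' = 0"
proof (rule hausdorff_measure_zeroI[where 'c = "3 \<Rightarrow> int"])
  show "0 < s / \<theta>" using s \<theta> by simp
next
  fix \<eta> :: real assume \<eta>: "0 < \<eta>"
  have adm: "admissible_data m m1 m2 D" using sponge by (simp add: self_affine_sponge_def)
  obtain \<kappa> where lc: "\<And>d. line_coding (alphabet m m1 m2) (ratio D d) (offset D d) (digits d) \<kappa>"
    using admissible_data_line_coding[OF adm] by blast
  have \<kappa>: "0 < \<kappa>" using line_coding.kappa_pos[OF lc] .
  \<comment> \<open>\<open>K ^ 3\<close> bounds the number of codes for one covering set, since an interval of length \<open>3 * r\<close> is
    \<open>3 / \<kappa>\<close> grid steps long; the power of \<open>3\<close> comes from the diameter \<open>3 * r powr \<theta>\<close>.\<close>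
  define K where "K = nat (\<lceil>3 / \<kappa>\<rceil> + 1)"
  define M where "M = real (K ^ 3) * 3 powr (s / \<theta>)"
  have "0 < \<lceil>3 / \<kappa>\<rceil>" using \<kappa> by simp
  then have "0 < K" unfolding K_def by linarith
  then have M: "0 < M" by (simp add: M_def)
  \<comment> \<open>The bound by \<open>1\<close> keeps all radii at most \<open>1\<close>, the scales at which approximate cubes are large.\<close>
  define \<eta>' where "\<eta>' = min 1 (\<eta> / M)"
  have \<eta>': "0 < \<eta>'" "\<eta>' \<le> 1" "M * \<eta>' \<le> \<eta>"
    using \<eta> M by (auto simp: \<eta>'_def min_def field_simps)
  obtain U r where r: "\<And>n::nat. 0 < (r n :: real)"
    and U: "\<And>n x y. x \<in> U n \<Longrightarrow> y \<in> U n \<Longrightarrow> dist x y \<le> r n"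
    and cov: "\<Lambda> \<subseteq> (\<Union>n. U n)" and sum: "(\<Sum>n. ennreal (r n powr s)) \<le> ennreal \<eta>'"
    by (rule hausdorff_measure_zeroD[OF null s \<eta>'(1)]) (rule that; assumption)
  have r1: "r n \<le> 1" for n
  proof -
    have "ennreal (r n powr s) = (\<Sum>k\<in>{n}. ennreal (r k powr s))" by simp
    also have "\<dots> \<le> (\<Sum>k. ennreal (r k powr s))" by (rule sum_le_suminf) auto
    also have "\<dots> \<le> ennreal 1" using sum \<eta>'(2) by (meson ennreal_leI order_trans)
    finally have "r n powr s \<le> 1" by simp
    then show ?thesis using s gr_one_powr[of "r n" s] by linarith
  qed
  \<comment> \<open>An empty \<open>U n\<close> has no centre; the arbitrary value of \<open>p n\<close> then only adds harmless codes.\<close>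
  define p where "p n = (SOME q. q \<in> U n)" for n
  define F where "F n = PiE UNIV (\<lambda>d. {\<lfloor>(p n $ d - 2 * r n) / (\<kappa> * r n)\<rfloor>..\<lfloor>(p n $ d + r n) / (\<kappa> * r n)\<rfloor>})" for n
  define V where "V n f = {x. \<exists>\<omega>. (\<forall>l. \<omega> l \<in> alphabet m m1 m2) \<and> addressed D' \<Lambda>' \<omega> x \<and>
    cube_code D \<kappa> (r n) \<omega> = f}" for n f
  have finF: "finite (F n)" for n by (simp add: F_def finite_PiE)
  have cardF: "card (F n) \<le> K ^ 3" for n
  proof -
    have "card {\<lfloor>(p n $ d - 2 * r n) / (\<kappa> * r n)\<rfloor>..\<lfloor>(p n $ d + r n) / (\<kappa> * r n)\<rfloor>} \<le> K" for d
    proof -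
      have "(p n $ d + r n) / (\<kappa> * r n) = (p n $ d - 2 * r n) / (\<kappa> * r n) + 3 / \<kappa>"
        using \<kappa> r[of n] by (simp add: field_simps)
      then have "\<lfloor>(p n $ d + r n) / (\<kappa> * r n)\<rfloor> \<le> \<lfloor>(p n $ d - 2 * r n) / (\<kappa> * r n)\<rfloor> + \<lceil>3 / \<kappa>\<rceil>"
        by linarith
      then show ?thesis by (simp add: K_def)
    qed
    then have "card (F n) \<le> (\<Prod>d\<in>(UNIV :: 3 set). K)"
      unfolding F_def by (subst card_PiE[OF finite]) (rule prod_mono, simp del: card_atLeastAtMost_int)
    then show ?thesis by simp
  qed
  have "\<forall>n. finite (F n) \<and> 0 \<le> 3 * r n powr \<theta>" by (simp add: finF)
  moreover have "\<forall>n. \<forall>f\<in>F n. \<forall>x\<in>V n f. \<forall>y\<in>V n f. dist x y \<le> 3 * r n powr \<theta>"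
  proof (intro allI ballI)
    fix n f x y assume x: "x \<in> V n f" and y: "y \<in> V n f"
    obtain \<omega> where \<omega>: "\<forall>l. \<omega> l \<in> alphabet m m1 m2" "addressed D' \<Lambda>' \<omega> x" "cube_code D \<kappa> (r n) \<omega> = f"
      using x unfolding V_def by blast
    obtain \<omega>' where \<omega>': "\<forall>l. \<omega>' l \<in> alphabet m m1 m2" "addressed D' \<Lambda>' \<omega>' y" "cube_code D \<kappa> (r n) \<omega>' = f"
      using y unfolding V_def by blast
    show "dist x y \<le> 3 * r n powr \<theta>"
      by (rule same_cube_code_imp_close[where \<omega> = \<omega> and \<omega>' = \<omega>', OF adm lc sponge' ratios \<theta> r r1])
        (use \<omega> \<omega>' in auto)
  qed
  moreover have "\<Lambda>' \<subseteq> (\<Union>n. \<Union>f\<in>F n. V n f)"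
  proof
    fix x assume "x \<in> \<Lambda>'"
    then obtain \<omega> where \<omega>: "\<forall>l. \<omega> l \<in> alphabet m m1 m2" "addressed D' \<Lambda>' \<omega> x"
      using address_exists[OF sponge'] by blast
    obtain q where q: "q \<in> \<Lambda>" "addressed D \<Lambda> \<omega> q"
      by (rule addressed_point_exists[where \<omega> = \<omega>, OF sponge spec[OF \<omega>(1)]])
    obtain n where n: "q \<in> U n" using q(1) cov by blast
    then have "p n \<in> U n" unfolding p_def by (rule someI)
    then have "dist (p n) q \<le> r n" using U n by blast
    from cube_code_range[where \<omega> = \<omega>, OF sponge lc r spec[OF \<omega>(1)] q(2) this] have "cube_code D \<kappa> (r n) \<omega> \<in> F n"
      by (simp add: F_def PiE_iff)
    moreover have "x \<in> V n (cube_code D \<kappa> (r n) \<omega>)" unfolding V_def using \<omega> by blast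
    ultimately show "x \<in> (\<Union>n. \<Union>f\<in>F n. V n f)" by blast
  qed
  moreover have "(\<Sum>n. of_nat (card (F n)) * ennreal ((3 * r n powr \<theta>) powr (s / \<theta>))) \<le> ennreal \<eta>"
  proof -
    have "of_nat (card (F n)) * ennreal ((3 * r n powr \<theta>) powr (s / \<theta>)) \<le> ennreal M * ennreal (r n powr s)" for n
    proof -
      have powr: "(3 * r n powr \<theta>) powr (s / \<theta>) = 3 powr (s / \<theta>) * r n powr s"
        using \<theta> by (simp add: powr_mult powr_powr)
      have "of_nat (card (F n)) * ennreal ((3 * r n powr \<theta>) powr (s / \<theta>))
          = ennreal (real (card (F n)) * (3 powr (s / \<theta>) * r n powr s))"
        unfolding powr by (simp add: ennreal_mult ennreal_of_nat_eq_real_of_nat)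
      also have "\<dots> \<le> ennreal (real (K ^ 3) * (3 powr (s / \<theta>) * r n powr s))"
        using cardF[of n] by (intro ennreal_leI mult_right_mono) (auto simp flip: of_nat_power)
      also have "\<dots> = ennreal M * ennreal (r n powr s)"
        using M by (simp add: M_def ennreal_mult[symmetric] mult.assoc)
      finally show ?thesis .
    qed
    then have "(\<Sum>n. of_nat (card (F n)) * ennreal ((3 * r n powr \<theta>) powr (s / \<theta>)))
        \<le> (\<Sum>n. ennreal M * ennreal (r n powr s))"
      by (intro suminf_le) auto
    also have "\<dots> \<le> ennreal M * ennreal \<eta>'"
      using sum by (simp add: mult_left_mono)
    also have "\<dots> \<le> ennreal \<eta>"
      using \<eta>' M by (simp add: ennreal_mult[symmetric] ennreal_leI)
    finally show ?thesis .
  qed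
  ultimately show "\<exists>V F \<rho>.
      (\<forall>n. finite (F n) \<and> 0 \<le> \<rho> n) \<and>
      (\<forall>n. \<forall>f\<in>F n. \<forall>x\<in>V n (f :: 3 \<Rightarrow> int). \<forall>y\<in>V n f. dist x y \<le> \<rho> n) \<and>
      \<Lambda>' \<subseteq> (\<Union>n. \<Union>f\<in>F n. V n f) \<and>
      (\<Sum>n. of_nat (card (F n)) * ennreal (\<rho> n powr (s / \<theta>))) \<le> ennreal \<eta>"
    by (intro exI[of _ V] exI[of _ F] exI[of _ "\<lambda>n. 3 * r n powr \<theta>"]) blast
qed


section \<open>Comparison of dimensions\<close>

text \<open>
  The factor \<open>1 / \<theta>\<close> turns into an additive error because only exponents up to \<open>4\<close> matter, the sponge
  lying in the unit cube.
\<close>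

lemma hausdorff_dim_transfer:
  assumes sponge: "self_affine_sponge m m1 m2 D \<Lambda>" and sponge': "self_affine_sponge m m1 m2 D' \<Lambda>'"
    and ratios: "\<And>d \<iota>. \<iota> \<in> alphabet m m1 m2 \<Longrightarrow> ratio D' d \<iota> \<le> ratio D d \<iota> powr \<theta>"
    and \<theta>: "0 < \<theta>" "\<theta> \<le> 1"
  shows "hausdorff_dim \<Lambda>' \<le> hausdorff_dim \<Lambda> + ereal (4 * (1 / \<theta> - 1))"
proof -
  have transfer: "hausdorff_dim \<Lambda>' \<le> ereal (s / \<theta>)" if s: "0 \<le> s" and null: "hausdorff_measure s \<Lambda> = 0" for s
  proof -
    have "s \<noteq> 0"
      using hausdorff_measure_zero_dimension[of \<Lambda>] null sponge by (auto simp: self_affine_sponge_def)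
    then have "0 < s" using s by simp
    then have "hausdorff_measure (s / \<theta>) \<Lambda>' = 0"
      using hausdorff_measure_zero_transfer[OF sponge sponge' ratios \<theta>(1) _ null] by blast
    then show ?thesis
      unfolding hausdorff_dim_def using s \<theta> by (intro Inf_lower) auto
  qed
  have "hausdorff_dim \<Lambda>' - ereal (4 * (1 / \<theta> - 1)) \<le> ereal s"
    if s: "0 \<le> s" and null: "hausdorff_measure s \<Lambda> = 0" for s
  proof -
    have "hausdorff_measure 4 \<Lambda> = 0"
      using self_affine_sponge_unit_cube[OF sponge] by (intro hausdorff_measure_4_unit_cube)
    then have "hausdorff_dim \<Lambda>' \<le> ereal (min s 4 / \<theta>)"
      using transfer[OF s null] transfer[of 4] by (auto simp: min_def)
    also have "min s 4 / \<theta> = min s 4 + min s 4 * (1 / \<theta> - 1)"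
      by (simp add: algebra_simps)
    also have "\<dots> \<le> s + 4 * (1 / \<theta> - 1)"
      using \<theta> by (intro add_mono mult_right_mono) auto
    finally have "hausdorff_dim \<Lambda>' \<le> ereal s + ereal (4 * (1 / \<theta> - 1))" by simp
    then show ?thesis by (simp add: ereal_minus_le)
  qed
  then have "hausdorff_dim \<Lambda>' - ereal (4 * (1 / \<theta> - 1)) \<le> hausdorff_dim \<Lambda>"
    unfolding hausdorff_dim_def[of \<Lambda>] by (intro Inf_greatest) auto
  then show ?thesis by (simp add: ereal_minus_le)
qed

text \<open>
  Since one of \<open>- ln x\<close> and \<open>- ln y\<close> is at least \<open>- ln c\<close>, an additive error \<open>\<epsilon>\<close> between the logarithms
  is at most the proportion \<open>\<epsilon> / (- ln c)\<close> of it. When it is \<open>- ln y\<close>, the proportion is taken of the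
  wrong side, which costs nothing because \<open>(1 - t) * (1 + t) \<le> 1\<close>.
\<close>

lemma le_powr_of_ln_close:
  fixes c x y \<epsilon> :: real
  assumes c: "0 < c" "c < 1" and \<epsilon>: "0 \<le> \<epsilon>" "\<epsilon> \<le> - ln c" and pos: "0 < x" "0 < y"
    and close: "\<bar>ln x - ln y\<bar> \<le> \<epsilon>" and small: "x \<le> c \<or> y \<le> c"
  shows "y \<le> x powr (1 - \<epsilon> / (- ln c))"
proof -
  define L where "L = - ln c"
  have L: "0 < L" "\<epsilon> \<le> L" using c \<epsilon> by (auto simp: L_def)
  have "ln y \<le> (1 - \<epsilon> / L) * ln x"
  proof (cases "x \<le> c")
    case True
    then have "L \<le> - ln x" using pos c by (simp add: L_def)
    then have "\<epsilon> / L * L \<le> \<epsilon> / L * (- ln x)" using \<epsilon> L by (intro mult_left_mono) auto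
    then have "\<epsilon> \<le> \<epsilon> / L * (- ln x)" using L by simp
    then show ?thesis using close by (simp add: left_diff_distrib)
  next
    case False
    then have "L \<le> - ln y" using small pos c by (auto simp: L_def)
    then have "\<epsilon> / L * L \<le> \<epsilon> / L * (- ln y)" using \<epsilon> L by (intro mult_left_mono) auto
    then have 1: "\<epsilon> \<le> \<epsilon> / L * (- ln y)" using L by simp
    have "0 \<le> \<epsilon> / L * \<epsilon>" using \<epsilon> L by simp
    then have "ln y \<le> (1 - \<epsilon> / L) * (ln y - \<epsilon>)"
      using 1 by (simp add: algebra_simps)
    also have "\<dots> \<le> (1 - \<epsilon> / L) * ln x"
      using close L by (intro mult_left_mono) (auto simp: field_simps)
    finally show ?thesis .
  qed
  then have "exp (ln y) \<le> exp ((1 - \<epsilon> / L) * ln x)" by simp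
  then show ?thesis using pos by (simp add: powr_def L_def)
qed

definition model_ratio :: "real \<Rightarrow> real \<Rightarrow> real \<Rightarrow> 3 \<Rightarrow> real" where
  "model_ratio a b c d = (if d = 1 then a else if d = 2 then b else c)"

lemma abc_sponge_ln_ratio:
  assumes sponge: "abc_sponge m m1 m2 a b c \<epsilon> \<Lambda>" and abc: "0 < a" "0 < b" "0 < c"
  obtains D where "self_affine_sponge m m1 m2 D \<Lambda>"
    "\<forall>d. \<forall>\<iota>\<in>alphabet m m1 m2. \<bar>ln (ratio D d \<iota>) - ln (model_ratio a b c d)\<bar> \<le> \<epsilon>"
proof -
  obtain D where D: "self_affine_sponge m m1 m2 D \<Lambda>"
    and close: "\<forall>(i, j, k)\<in>alphabet m m1 m2.
      len3 D i j k / a \<in> {exp (- \<epsilon>)..exp \<epsilon>} \<and> len2 D i j / b \<in> {exp (- \<epsilon>)..exp \<epsilon>} \<and>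
      len1 D i / c \<in> {exp (- \<epsilon>)..exp \<epsilon>}"
    using sponge by (auto simp: abc_sponge_def)
  have "\<bar>ln (ratio D d \<iota>) - ln (model_ratio a b c d)\<bar> \<le> \<epsilon>" if \<iota>: "\<iota> \<in> alphabet m m1 m2" for d \<iota>
  proof -
    have adm: "admissible_data m m1 m2 D" using D by (simp add: self_affine_sponge_def)
    have pos: "0 < ratio D d \<iota>" "0 < model_ratio a b c d"
      using admissible_data_coordinate(1)[OF adm \<iota>] abc by (auto simp: model_ratio_def)
    have quot: "exp (- \<epsilon>) \<le> ratio D d \<iota> / model_ratio a b c d" "ratio D d \<iota> / model_ratio a b c d \<le> exp \<epsilon>"
      using close \<iota> by (auto simp: ratio_def model_ratio_def)
    have "ln (exp (- \<epsilon>)) \<le> ln (ratio D d \<iota> / model_ratio a b c d)"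
      using quot(1) by (subst ln_le_cancel_iff) (use pos in auto)
    moreover have "ln (ratio D d \<iota> / model_ratio a b c d) \<le> ln (exp \<epsilon>)"
      using quot(2) by (subst ln_le_cancel_iff) (use pos in auto)
    ultimately show ?thesis using pos by (simp add: ln_div abs_le_iff)
  qed
  with D show ?thesis by (intro that) auto
qed

theorem theorem2:
  fixes m :: nat and m1 :: "nat \<Rightarrow> nat" and m2 :: "nat \<Rightarrow> nat \<Rightarrow> nat" and a b c :: real
  assumes "alphabet_sizes m m1 m2"
    and "0 < a" and "a \<le> b" and "b \<le> c" and "c < 1"
    and "t_lower m m1 m2 a < t_upper m m1 m2 a"
  shows "\<exists>C::real. \<forall>\<Lambda>\<^sub>0. sierpinski_sponge m m1 m2 a b c \<Lambda>\<^sub>0 \<longrightarrow>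
    (\<forall>\<^sub>F \<epsilon> in at_right (0::real). \<forall>\<Lambda>. abc_sponge m m1 m2 a b c \<epsilon> \<Lambda> \<longrightarrow>
       hausdorff_dim \<Lambda>\<^sub>0 - ereal (C * \<epsilon>) \<le> hausdorff_dim \<Lambda> \<and>
       hausdorff_dim \<Lambda> \<le> hausdorff_dim \<Lambda>\<^sub>0 + ereal (C * \<epsilon>))"
proof -
  have abc: "0 < a" "0 < b" "0 < c" using assms by auto
  define L where "L = - ln c"
  have L: "0 < L" using abc assms(5) by (simp add: L_def)
  have model: "0 < model_ratio a b c d" "model_ratio a b c d \<le> c" for d
    using assms abc by (auto simp: model_ratio_def)
  \<comment> \<open>\<open>8 = 4 * 2\<close>: the bound \<open>4\<close> on the exponents, and \<open>1 / \<theta> \<le> 2\<close> once \<open>\<epsilon> \<le> L / 2\<close>.\<close>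
  have bounds: "hausdorff_dim \<Lambda>\<^sub>0 - ereal (8 / L * \<epsilon>) \<le> hausdorff_dim \<Lambda> \<and>
      hausdorff_dim \<Lambda> \<le> hausdorff_dim \<Lambda>\<^sub>0 + ereal (8 / L * \<epsilon>)"
    if S: "sierpinski_sponge m m1 m2 a b c \<Lambda>\<^sub>0" "abc_sponge m m1 m2 a b c \<epsilon> \<Lambda>" and \<epsilon>: "0 < \<epsilon>" "\<epsilon> \<le> L / 2"
    for \<Lambda>\<^sub>0 \<Lambda> \<epsilon>
  proof -
    obtain D\<^sub>0 where D\<^sub>0: "self_affine_sponge m m1 m2 D\<^sub>0 \<Lambda>\<^sub>0"
      "\<forall>d. \<forall>\<iota>\<in>alphabet m m1 m2. \<bar>ln (ratio D\<^sub>0 d \<iota>) - ln (model_ratio a b c d)\<bar> \<le> 0"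
      using abc_sponge_ln_ratio[OF S(1)[unfolded sierpinski_sponge_def] abc] by blast
    obtain D where D: "self_affine_sponge m m1 m2 D \<Lambda>"
      "\<forall>d. \<forall>\<iota>\<in>alphabet m m1 m2. \<bar>ln (ratio D d \<iota>) - ln (model_ratio a b c d)\<bar> \<le> \<epsilon>"
      using abc_sponge_ln_ratio[OF S(2) abc] by blast
    have pos: "0 < ratio D\<^sub>0 d \<iota>" "0 < ratio D d \<iota>" if "\<iota> \<in> alphabet m m1 m2" for d \<iota>
      using that D\<^sub>0(1) D(1) by (auto simp: self_affine_sponge_def intro: admissible_data_coordinate)
    have eq: "ratio D\<^sub>0 d \<iota> = model_ratio a b c d" if "\<iota> \<in> alphabet m m1 m2" for d \<iota>
      using D\<^sub>0(2)[rule_format, OF that, of d] pos(1)[OF that] model(1) by simp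
    define \<theta> where "\<theta> = 1 - \<epsilon> / L"
    have \<theta>: "1 / 2 \<le> \<theta>" "\<theta> \<le> 1" using \<epsilon> L by (auto simp: \<theta>_def field_simps)
    have "1 / \<theta> - 1 = (1 - \<theta>) / \<theta>" using \<theta> by (simp add: diff_divide_distrib)
    also have "1 - \<theta> = \<epsilon> / L" by (simp add: \<theta>_def)
    also have "\<epsilon> / L / \<theta> \<le> \<epsilon> / L / (1 / 2)" using \<theta> \<epsilon> L by (intro divide_left_mono) auto
    finally have err: "4 * (1 / \<theta> - 1) \<le> 8 / L * \<epsilon>" by simp
    have up: "ratio D d \<iota> \<le> ratio D\<^sub>0 d \<iota> powr \<theta>" if "\<iota> \<in> alphabet m m1 m2" for d \<iota>
      unfolding \<theta>_def L_def using abc assms(5) \<epsilon> L pos[OF that, of d] D(2)[rule_format, OF that, of d] model(2)[of d] eq[OF that, of d]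
      by (intro le_powr_of_ln_close) (auto simp: L_def abs_minus_commute)
    have down: "ratio D\<^sub>0 d \<iota> \<le> ratio D d \<iota> powr \<theta>" if "\<iota> \<in> alphabet m m1 m2" for d \<iota>
      unfolding \<theta>_def L_def using abc assms(5) \<epsilon> L pos[OF that, of d] D(2)[rule_format, OF that, of d] model(2)[of d] eq[OF that, of d]
      by (intro le_powr_of_ln_close) (auto simp: L_def abs_minus_commute)
    have "hausdorff_dim \<Lambda> \<le> hausdorff_dim \<Lambda>\<^sub>0 + ereal (4 * (1 / \<theta> - 1))"
      using \<theta> by (intro hausdorff_dim_transfer[OF D\<^sub>0(1) D(1) up]) auto
    also have "\<dots> \<le> hausdorff_dim \<Lambda>\<^sub>0 + ereal (8 / L * \<epsilon>)"
      using err by (intro add_left_mono) simp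
    finally have upper: "hausdorff_dim \<Lambda> \<le> hausdorff_dim \<Lambda>\<^sub>0 + ereal (8 / L * \<epsilon>)" .
    have "hausdorff_dim \<Lambda>\<^sub>0 \<le> hausdorff_dim \<Lambda> + ereal (4 * (1 / \<theta> - 1))"
      using \<theta> by (intro hausdorff_dim_transfer[OF D(1) D\<^sub>0(1) down]) auto
    also have "\<dots> \<le> hausdorff_dim \<Lambda> + ereal (8 / L * \<epsilon>)"
      using err by (intro add_left_mono) simp
    finally have "hausdorff_dim \<Lambda>\<^sub>0 - ereal (8 / L * \<epsilon>) \<le> hausdorff_dim \<Lambda>"
      by (simp add: ereal_minus_le)
    with upper show ?thesis by blast
  qed
  have "\<forall>\<^sub>F \<epsilon> in at_right 0. 0 < \<epsilon> \<and> \<epsilon> \<le> L / 2"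
    using eventually_at_right_real[of 0 "L / 2"] L by (auto elim: eventually_mono)
  then have "\<forall>\<^sub>F \<epsilon> in at_right 0. \<forall>\<Lambda>. abc_sponge m m1 m2 a b c \<epsilon> \<Lambda> \<longrightarrow>
      hausdorff_dim \<Lambda>\<^sub>0 - ereal (8 / L * \<epsilon>) \<le> hausdorff_dim \<Lambda> \<and>
      hausdorff_dim \<Lambda> \<le> hausdorff_dim \<Lambda>\<^sub>0 + ereal (8 / L * \<epsilon>)"
    if "sierpinski_sponge m m1 m2 a b c \<Lambda>\<^sub>0" for \<Lambda>\<^sub>0
    by (rule eventually_mono) (use bounds[OF that] in blast)
  then show ?thesis by blast
qed

end
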